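(* Let $X$ be a $\delta$-hyperbolic proper geodesic metric space with bounded growth at some scale. Then for any $\xi\in\partial X$, any $p\in X$ and any $0<\epsilon\le\epsilon_0$, the metric space $(\partial X\setminus\{\xi\},d_{\xi,p,\epsilon})$ is doubling.
   Context: $X$ has Gromov boundary $\partial X$. Busemann function: for a ray $\gamma$ from $p$ to $\xi$, $B_\gamma(x)=\lim_{t\to\infty}(d(\gamma(t),x)-t)$, $B_{\xi,p}=\sup_\gamma B_\gamma$ over rays from $p$ to $\xi$. For distinct $\eta_1,\eta_2\in\partial X\setminus\{\xi\}$, $H_{\xi,p}(\eta_1,\eta_2)=\inf_\sigma\inf_{x\in\sigma}B_{\xi,p}(x)$ over complete geodesics $\sigma$ from $\eta_1$ to $\eta_2$, and $D_{\xi,p,\epsilon}(\eta_1,\eta_2)=e^{-\epsilon H_{\xi,p}(\eta_1,\eta_2)}$. There is $\epsilon_0>0$ depending only on $\delta$ such that for $0<\epsilon\le\epsilon_0$ there exists a metric $d_{\xi,p,\epsilon}$ on $\partial X\setminus\{\xi\}$ with $\frac12D_{\xi,p,\epsilon}\le d_{\xi,p,\epsilon}\le D_{\xi,p,\epsilon}$ (a parabolic visual metric; any such metric is meant). A metric space has bounded growth at some scale if there are $R>r>0$ and an integer $N\ge1$ such that every open ball of radius $R$ can be covered by $N$ open balls of radius $r$. A metric space is doubling if there is $N$ such that every open ball of radius $R>0$ can be covered by at most $N$ open balls of radius $R/2$. *)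

theory Defs
  imports "HOL-Analysis.Analysis"
begin

definition gromov_product :: "'a::metric_space \<Rightarrow> 'a \<Rightarrow> 'a \<Rightarrow> real" where
  "gromov_product w x y = (dist w x + dist w y - dist x y) / 2"

definition delta_hyperbolic :: "real \<Rightarrow> 'a::metric_space itself \<Rightarrow> bool" where
  "delta_hyperbolic \<delta> _ \<longleftrightarrow> \<delta> \<ge> 0 \<and>
     (\<forall>w x y z::'a. gromov_product w x y \<ge> min (gromov_product w x z) (gromov_product w y z) - \<delta>)"

definition proper_metric :: "'a::metric_space itself \<Rightarrow> bool" where
  "proper_metric _ \<longleftrightarrow> (\<forall>(x::'a) r. compact (cball x r))"

definition geodesic_metric :: "'a::metric_space itself \<Rightarrow> bool" where
  "geodesic_metric _ \<longleftrightarrow> (\<forall>x y::'a. \<exists>g::real \<Rightarrow> 'a. g 0 = x \<and> g (dist x y) = y \<and>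
      (\<forall>s\<in>{0..dist x y}. \<forall>t\<in>{0..dist x y}. dist (g s) (g t) = \<bar>s - t\<bar>))"

definition bounded_growth_some_scale :: "'a::metric_space itself \<Rightarrow> bool" where
  "bounded_growth_some_scale _ \<longleftrightarrow> (\<exists>R r. \<exists>N::nat. 0 < r \<and> r < R \<and> N \<ge> 1 \<and>
     (\<forall>x::'a. \<exists>C. finite C \<and> card C \<le> N \<and> ball x R \<subseteq> (\<Union>c\<in>C. ball c r)))"

definition geodesic_ray :: "(real \<Rightarrow> 'a::metric_space) \<Rightarrow> bool" where
  "geodesic_ray \<gamma> \<longleftrightarrow> (\<forall>s\<ge>0. \<forall>t\<ge>0. dist (\<gamma> s) (\<gamma> t) = \<bar>s - t\<bar>)"

definition asymp_rays :: "((real \<Rightarrow> 'a::metric_space) \<times> (real \<Rightarrow> 'a)) set" where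
  "asymp_rays = {(\<gamma>, \<gamma>'). geodesic_ray \<gamma> \<and> geodesic_ray \<gamma>' \<and>
                   (\<exists>C. \<forall>t\<ge>0. dist (\<gamma> t) (\<gamma>' t) \<le> C)}"

definition gromov_boundary :: "(real \<Rightarrow> 'a::metric_space) set set" where
  "gromov_boundary = {\<gamma>. geodesic_ray \<gamma>} // asymp_rays"

definition busemann_ray :: "(real \<Rightarrow> 'a::metric_space) \<Rightarrow> 'a \<Rightarrow> real" where
  "busemann_ray \<gamma> x = Lim at_top (\<lambda>t. dist (\<gamma> t) x - t)"

definition busemann :: "(real \<Rightarrow> 'a::metric_space) set \<Rightarrow> 'a \<Rightarrow> 'a \<Rightarrow> real" where
  "busemann \<xi> p x = Sup {busemann_ray \<gamma> x | \<gamma>. \<gamma> \<in> \<xi> \<and> \<gamma> 0 = p}"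

definition bi_geodesic :: "(real \<Rightarrow> 'a::metric_space) \<Rightarrow> bool" where
  "bi_geodesic \<sigma> \<longleftrightarrow> (\<forall>s t. dist (\<sigma> s) (\<sigma> t) = \<bar>s - t\<bar>)"

definition geodesic_between ::
  "(real \<Rightarrow> 'a::metric_space) set \<Rightarrow> (real \<Rightarrow> 'a) set \<Rightarrow> (real \<Rightarrow> 'a) \<Rightarrow> bool" where
  "geodesic_between \<eta>1 \<eta>2 \<sigma> \<longleftrightarrow> bi_geodesic \<sigma> \<and> \<sigma> \<in> \<eta>2 \<and> (\<lambda>t. \<sigma> (- t)) \<in> \<eta>1"

definition H_fun :: "(real \<Rightarrow> 'a::metric_space) set \<Rightarrow> 'a \<Rightarrow>
                     (real \<Rightarrow> 'a) set \<Rightarrow> (real \<Rightarrow> 'a) set \<Rightarrow> real" where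
  "H_fun \<xi> p \<eta>1 \<eta>2 = Inf {busemann \<xi> p x | x \<sigma>. geodesic_between \<eta>1 \<eta>2 \<sigma> \<and> x \<in> range \<sigma>}"

definition D_fun :: "(real \<Rightarrow> 'a::metric_space) set \<Rightarrow> 'a \<Rightarrow> real \<Rightarrow>
                     (real \<Rightarrow> 'a) set \<Rightarrow> (real \<Rightarrow> 'a) set \<Rightarrow> real" where
  "D_fun \<xi> p \<epsilon> \<eta>1 \<eta>2 = exp (- \<epsilon> * H_fun \<xi> p \<eta>1 \<eta>2)"

definition metric_on :: "'b set \<Rightarrow> ('b \<Rightarrow> 'b \<Rightarrow> real) \<Rightarrow> bool" where
  "metric_on S d \<longleftrightarrow> (\<forall>x\<in>S. \<forall>y\<in>S. (d x y = 0 \<longleftrightarrow> x = y) \<and> d x y = d y x) \<and>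
                     (\<forall>x\<in>S. \<forall>y\<in>S. \<forall>z\<in>S. d x z \<le> d x y + d y z)"

definition parabolic_visual_metric ::
  "(real \<Rightarrow> 'a::metric_space) set \<Rightarrow> 'a \<Rightarrow> real \<Rightarrow>
   ((real \<Rightarrow> 'a) set \<Rightarrow> (real \<Rightarrow> 'a) set \<Rightarrow> real) \<Rightarrow> bool" where
  "parabolic_visual_metric \<xi> p \<epsilon> d \<longleftrightarrow>
     metric_on (gromov_boundary - {\<xi>}) d \<and>
     (\<forall>\<eta>1\<in>gromov_boundary - {\<xi>}. \<forall>\<eta>2\<in>gromov_boundary - {\<xi>}. \<eta>1 \<noteq> \<eta>2 \<longrightarrow>
        D_fun \<xi> p \<epsilon> \<eta>1 \<eta>2 / 2 \<le> d \<eta>1 \<eta>2 \<and> d \<eta>1 \<eta>2 \<le> D_fun \<xi> p \<epsilon> \<eta>1 \<eta>2)"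

definition doubling_on :: "'b set \<Rightarrow> ('b \<Rightarrow> 'b \<Rightarrow> real) \<Rightarrow> bool" where
  "doubling_on S d \<longleftrightarrow> (\<exists>N::nat. \<forall>x\<in>S. \<forall>R>0. \<exists>C. finite C \<and> C \<subseteq> S \<and> card C \<le> N \<and>
      {y\<in>S. d x y < R} \<subseteq> (\<Union>c\<in>C. {y\<in>S. d c y < R / 2}))"

end

theory Submission
  imports Defs
begin

text \<open>
  Fix a ray \<open>\<gamma>\<close> from \<open>p\<close> to \<open>\<xi>\<close> with Busemann function \<open>b\<close>. The product
  \<open>(b x + b y - dist x y) / 2\<close> is a limit of Gromov products based at \<open>\<gamma> t\<close>, hence satisfies the
  \<open>\<delta>\<close>-inequality, and along rays to \<open>\<eta>1\<close> and \<open>\<eta>2\<close> it equals the height \<open>H \<eta>1 \<eta>2\<close> up to a multiple of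
  \<open>\<delta>\<close>. Given boundary points in a ball of radius \<open>R\<close> that are pairwise \<open>R / 2\<close> apart, their heights
  relative to the centre exceed some \<open>h\<close>, and their mutual heights are at most \<open>h + ln 4 / \<epsilon>\<close>. On
  geodesics from a far point of \<open>\<gamma>\<close> towards these boundary points, the points at height \<open>h\<close> are
  therefore within \<open>4 * \<delta>\<close> of each other, while slightly above height \<open>h + ln 4 / \<epsilon>\<close> they are
  separated by any prescribed amount. This yields a separated set of the same cardinality in a ball
  of \<open>X\<close> of fixed radius, and bounded growth at one scale bounds its size.
\<close>

subsection \<open>Cluster points of geodesics and the boundary\<close>

lemma gromov_product_commute: "gromov_product w x y = gromov_product w y x"
  by (simp add: gromov_product_def dist_commute)

text \<open>Tychonoff's theorem makes the product of the closed balls compact, so the sequence of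
  maps has a cluster point in the topology of pointwise convergence. Closed conditions on one or two
  coordinates that hold eventually pass to it; this is how limits of geodesics are obtained
  below.\<close>

lemma pointwise_cluster_point:
  fixes g :: "nat \<Rightarrow> real \<Rightarrow> 'a::metric_space"
  assumes proper: "proper_metric TYPE('a)"
    and bd: "\<And>n t. dist x0 (g n t) \<le> K t"
  obtains G where
    "\<And>s t c. eventually (\<lambda>n. dist (g n s) (g n t) = c) sequentially \<Longrightarrow> dist (G s) (G t) = c"
    "\<And>t q C. eventually (\<lambda>n. dist (g n t) q \<le> C) sequentially \<Longrightarrow> dist (G t) q \<le> C"
proof -
  have "compact (PiE UNIV (\<lambda>t. cball x0 (K t)))"
    using proper compactin_PiE[of "\<lambda>_::real. euclidean :: 'a topology" UNIV "\<lambda>t. cball x0 (K t)"]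
    by (simp add: proper_metric_def euclidean_product_topology flip: compactin_euclidean_iff)
  moreover have "eventually (\<lambda>f. f \<in> PiE UNIV (\<lambda>t. cball x0 (K t))) (filtermap g sequentially)"
    using bd by (simp add: eventually_filtermap PiE_UNIV_domain)
  moreover have "filtermap g sequentially \<noteq> bot"
    by (simp add: filtermap_bot_iff)
  ultimately obtain G where G: "inf (nhds G) (filtermap g sequentially) \<noteq> bot"
    unfolding compact_filter by blast
  \<comment> \<open>The set \<open>U\<close> is a basic neighbourhood of \<open>G\<close> in the
    product topology; a cluster point meets it also among the indices satisfying
    \<open>P\<close>.\<close>
  have close: "\<exists>n. P n \<and> (\<forall>t\<in>T. dist (g n t) (G t) < e)"
    if T: "finite T" "e > 0" and P: "eventually P sequentially" for T e P
  proof (rule ccontr)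
    assume neg: "\<not> ?thesis"
    define U where "U = (\<Inter>t\<in>T. (\<lambda>f. f t) -` ball (G t) e)"
    have "open U"
      unfolding U_def using T(1)
      by (intro open_INT ballI open_vimage open_ball continuous_on_product_coordinates) auto
    moreover have "G \<in> U" using T by (simp add: U_def)
    ultimately have "eventually (\<lambda>f. f \<in> U) (nhds G)"
      using eventually_nhds by blast
    moreover have "eventually (\<lambda>f. f \<notin> U) (filtermap g sequentially)"
      unfolding eventually_filtermap using P
      by eventually_elim (use neg in \<open>auto simp: U_def dist_commute\<close>)
    ultimately have "eventually (\<lambda>f. False) (inf (nhds G) (filtermap g sequentially))"
      unfolding eventually_inf by blast
    with G show False by (simp add: trivial_limit_def)
  qed
  show thesis
  proof (rule that)
    fix s t c assume ev: "eventually (\<lambda>n. dist (g n s) (g n t) = c) sequentially"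
    have "\<bar>dist (G s) (G t) - c\<bar> \<le> e" if e: "e > 0" for e
    proof -
      obtain n where "dist (g n s) (g n t) = c" "\<forall>u\<in>{s,t}. dist (g n u) (G u) < e / 2"
        using close[of "{s,t}" "e/2", OF _ _ ev] e by auto
      then show ?thesis
        using dist_triangle[of "g n s" "g n t" "G s"] dist_triangle[of "G s" "g n t" "G t"]
          dist_triangle[of "G s" "G t" "g n s"] dist_triangle[of "g n s" "G t" "g n t"]
        by (simp add: dist_commute abs_le_iff)
    qed
    then show "dist (G s) (G t) = c"
      using field_le_epsilon[of "\<bar>dist (G s) (G t) - c\<bar>" 0] by simp
  next
    fix t q C assume ev: "eventually (\<lambda>n. dist (g n t) q \<le> C) sequentially"
    show "dist (G t) q \<le> C"
    proof (rule field_le_epsilon)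
      fix e :: real assume "e > 0"
      then obtain n where "dist (g n t) q \<le> C" "dist (g n t) (G t) < e"
        using close[of "{t}" e, OF _ _ ev] by auto
      then show "dist (G t) q \<le> C + e"
        using dist_triangle[of "G t" q "g n t"] by (simp add: dist_commute)
    qed
  qed
qed

section \<open>Asymptotic rays and boundary classes\<close>

lemma equiv_asymp_rays: "equiv {\<gamma>. geodesic_ray \<gamma>} (asymp_rays :: ((real \<Rightarrow> 'a::metric_space) \<times> _) set)"
proof (rule equivI)
  show "refl_on {\<gamma>. geodesic_ray \<gamma>} (asymp_rays :: ((real \<Rightarrow> 'a) \<times> _) set)"
    by (auto simp: refl_on_def asymp_rays_def)
  show "sym (asymp_rays :: ((real \<Rightarrow> 'a) \<times> _) set)"
    by (auto simp: sym_def asymp_rays_def dist_commute)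
  show "trans (asymp_rays :: ((real \<Rightarrow> 'a) \<times> _) set)"
  proof (rule transI)
    fix x y z :: "real \<Rightarrow> 'a"
    assume xy: "(x, y) \<in> asymp_rays" and yz: "(y, z) \<in> asymp_rays"
    then obtain C C' where "\<forall>t\<ge>0. dist (x t) (y t) \<le> C" "\<forall>t\<ge>0. dist (y t) (z t) \<le> C'"
      by (auto simp: asymp_rays_def)
    then have "\<forall>t\<ge>0. dist (x t) (z t) \<le> C + C'"
      by (meson add_mono dist_triangle order_trans)
    then show "(x, z) \<in> asymp_rays" using xy yz by (auto simp: asymp_rays_def)
  qed
  show "asymp_rays \<subseteq> {\<gamma>. geodesic_ray \<gamma>} \<times> {\<gamma> :: real \<Rightarrow> 'a. geodesic_ray \<gamma>}"
    by (auto simp: asymp_rays_def)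
qed

lemma boundary_ray: "\<eta> \<in> gromov_boundary \<Longrightarrow> \<tau> \<in> \<eta> \<Longrightarrow> geodesic_ray \<tau>"
  using in_quotient_imp_subset[OF equiv_asymp_rays] unfolding gromov_boundary_def by blast

lemma boundary_nonempty: "\<eta> \<in> gromov_boundary \<Longrightarrow> \<eta> \<noteq> {}"
  using in_quotient_imp_non_empty[OF equiv_asymp_rays] unfolding gromov_boundary_def by blast

lemma boundary_asymp:
  "\<eta> \<in> gromov_boundary \<Longrightarrow> \<tau> \<in> \<eta> \<Longrightarrow> \<sigma> \<in> \<eta> \<Longrightarrow> (\<tau>, \<sigma>) \<in> asymp_rays"
  unfolding gromov_boundary_def
  using in_quotient_imp_in_rel[OF equiv_asymp_rays, of \<eta> \<tau> \<sigma>] by auto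

lemma boundary_closed:
  "\<eta> \<in> gromov_boundary \<Longrightarrow> \<tau> \<in> \<eta> \<Longrightarrow> (\<tau>, \<sigma>) \<in> asymp_rays \<Longrightarrow> \<sigma> \<in> \<eta>"
  unfolding gromov_boundary_def
  using in_quotient_imp_closed[OF equiv_asymp_rays] by blast

lemma boundary_not_asymp:
  "\<eta> \<in> gromov_boundary \<Longrightarrow> \<xi> \<in> gromov_boundary \<Longrightarrow> \<eta> \<noteq> \<xi> \<Longrightarrow> \<tau> \<in> \<eta> \<Longrightarrow> \<gamma> \<in> \<xi>
    \<Longrightarrow> (\<gamma>, \<tau>) \<notin> asymp_rays"
  unfolding gromov_boundary_def
  using quotient_eqI[OF equiv_asymp_rays] by blast

text \<open>\<open>Lim\<close> is informative only once convergence is known. By the triangle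
  inequality the function is nonincreasing on nonnegative times and bounded below by
  \<open>- dist (\<gamma> 0) x\<close>, so it converges to its infimum.\<close>

lemma tendsto_busemann_ray:
  assumes "geodesic_ray \<gamma>"
  shows "((\<lambda>t. dist (\<gamma> t) x - t) \<longlongrightarrow> busemann_ray \<gamma> x) at_top"
proof -
  define f where "f t = dist (\<gamma> t) x - t" for t
  have mono: "f t \<le> f s" if "0 \<le> s" "s \<le> t" for s t
  proof -
    have "dist (\<gamma> t) (\<gamma> s) = t - s"
      using assms that by (simp add: geodesic_ray_def)
    then show ?thesis
      unfolding f_def using dist_triangle[of "\<gamma> t" x "\<gamma> s"] by simp
  qed
  have bdd: "bdd_below (f ` {0..})"
  proof (rule bdd_belowI2)
    fix t :: real assume "t \<in> {0..}"
    then have "dist (\<gamma> 0) (\<gamma> t) = t" using assms by (simp add: geodesic_ray_def)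
    then show "- dist (\<gamma> 0) x \<le> f t"
      unfolding f_def using dist_triangle[of "\<gamma> 0" "\<gamma> t" x] by (simp add: dist_commute)
  qed
  have "(f \<longlongrightarrow> Inf (f ` {0..})) at_top"
  proof (rule order_tendstoI)
    fix a assume "a < Inf (f ` {0..})"
    then have "a < f t" if "t \<ge> 0" for t
      using cINF_lower[OF bdd, of t] that by simp
    then show "eventually (\<lambda>t. a < f t) at_top"
      using eventually_ge_at_top[of 0] by (rule eventually_mono[rotated])
  next
    fix a assume "a > Inf (f ` {0..})"
    then obtain s where s: "s \<ge> 0" "f s < a"
      using cInf_lessD[of "f ` {0..}" a] by auto
    show "eventually (\<lambda>t. f t < a) at_top"
      using eventually_ge_at_top[of s] by eventually_elim (use mono s in force)
  qed
  then show ?thesis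
    unfolding busemann_ray_def f_def[symmetric]
    using tendsto_Lim[OF trivial_limit_at_top_linorder, of f] by simp
qed

subsection \<open>Doubling and bounded growth\<close>

text \<open>A separated subset of largest cardinality in a ball is also a net: a point of the ball
  at distance at least \<open>R / 2\<close> from all its members could be added to it.\<close>

lemma doubling_on_if_separated_bounded:
  assumes metric: "metric_on S d"
    and N: "\<And>x R P. \<lbrakk>x \<in> S; R > 0; finite P; P \<subseteq> {y \<in> S. d x y < R};
              \<And>y z. \<lbrakk>y \<in> P; z \<in> P; y \<noteq> z\<rbrakk> \<Longrightarrow> R / 2 \<le> d y z\<rbrakk> \<Longrightarrow> card P \<le> N"
  shows "doubling_on S d"
  unfolding doubling_on_def
proof (intro exI[of _ N] ballI allI impI)
  fix x and R :: real assume x: "x \<in> S" and R: "R > 0"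
  define sep where "sep P \<longleftrightarrow> finite P \<and> P \<subseteq> {y \<in> S. d x y < R} \<and>
    (\<forall>y\<in>P. \<forall>z\<in>P. y \<noteq> z \<longrightarrow> R / 2 \<le> d y z)" for P
  have bound: "card P \<le> N" if "sep P" for P
    using N[OF x R, of P] that unfolding sep_def by blast
  have "sep {}" by (simp add: sep_def)
  then have "\<exists>C. sep C \<and> (\<forall>P. sep P \<longrightarrow> card P \<le> card C)"
    by (rule ex_has_greatest_nat[where b = "Suc N"]) (simp add: bound le_imp_less_Suc)
  then obtain C where C: "sep C" and max: "\<And>P. sep P \<Longrightarrow> card P \<le> card C"
    by blast
  have "\<exists>c\<in>C. d c y < R / 2" if y: "y \<in> S" "d x y < R" for y
  proof (rule ccontr)
    assume neg: "\<not> ?thesis"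
    have fin: "finite C" and CS: "C \<subseteq> S" using C by (auto simp: sep_def)
    have "d y y = 0" using metric y by (simp add: metric_on_def)
    then have "y \<notin> C" using neg R by auto
    moreover have "d y c = d c y" if "c \<in> C" for c
      using metric y CS that by (auto simp: metric_on_def)
    then have "sep (insert y C)"
      using C neg y unfolding sep_def by force
    ultimately show False
      using max[of "insert y C"] fin by simp
  qed
  then show "\<exists>C. finite C \<and> C \<subseteq> S \<and> card C \<le> N \<and>
      {y \<in> S. d x y < R} \<subseteq> (\<Union>c\<in>C. {y \<in> S. d c y < R / 2})"
    using C bound[OF C] by (intro exI[of _ C]) (auto simp: sep_def)
qed

section \<open>Coverings and separated sets at larger radii\<close>

lemma geodesic_between_points:
  fixes x y :: "'a::metric_space"
  assumes "geodesic_metric TYPE('a)"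
  obtains g where "g 0 = x" "g (dist x y) = y"
    "\<And>s t. \<lbrakk>0 \<le> s; s \<le> dist x y; 0 \<le> t; t \<le> dist x y\<rbrakk> \<Longrightarrow> dist (g s) (g t) = \<bar>s - t\<bar>"
proof -
  obtain g where g: "g 0 = x \<and> g (dist x y) = y \<and>
      (\<forall>s\<in>{0..dist x y}. \<forall>t\<in>{0..dist x y}. dist (g s) (g t) = \<bar>s - t\<bar>)"
    using assms unfolding geodesic_metric_def by metis
  show thesis by (rule that[of g]) (use g in auto)
qed

text \<open>Coverings propagate outwards from the given scale: a point slightly outside
  \<open>ball x \<rho>\<close> is within \<open>R - r\<close> of a point inside, hence within
  \<open>R\<close> of the centre of a covering \<open>r\<close>-ball, and the \<open>R\<close>-ball
  around that centre is again covered by \<open>N\<close> balls of radius \<open>r\<close>. A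
  \<open>2 * r\<close>-separated set has at most one point in each ball of radius
  \<open>r\<close>.\<close>

lemma bounded_growth_separated:
  assumes geod: "geodesic_metric TYPE('a::metric_space)"
    and growth: "bounded_growth_some_scale TYPE('a)"
  obtains r where "r > 0"
    "\<forall>\<rho>. \<exists>N. \<forall>(x::'a) (P::'a set). finite P \<longrightarrow> P \<subseteq> ball x \<rho> \<longrightarrow>
       (\<forall>y\<in>P. \<forall>z\<in>P. y \<noteq> z \<longrightarrow> 2 * r \<le> dist y z) \<longrightarrow> card P \<le> N"
proof -
  obtain R r and N :: nat where r: "0 < r" "r < R"
    and N: "\<And>x::'a. \<exists>C. finite C \<and> card C \<le> N \<and> ball x R \<subseteq> (\<Union>c\<in>C. ball c r)"
    using growth unfolding bounded_growth_some_scale_def by blast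
  have cover: "\<exists>M. \<forall>x::'a. \<exists>C. finite C \<and> card C \<le> M \<and> ball x (r + real k * (R - r)) \<subseteq> (\<Union>c\<in>C. ball c r)"
    for k :: nat
  proof (induction k)
    case 0
    show ?case by (rule exI[of _ 1], intro allI, rule_tac x="{x}" in exI) auto
  next
    case (Suc k)
    define \<rho> where "\<rho> = r + real k * (R - r)"
    have \<rho>: "\<rho> > 0" using r by (simp add: \<rho>_def add_pos_nonneg)
    obtain M where M: "\<And>x::'a. \<exists>C. finite C \<and> card C \<le> M \<and> ball x \<rho> \<subseteq> (\<Union>c\<in>C. ball c r)"
      using Suc unfolding \<rho>_def by blast
    obtain F where F: "\<And>x::'a. finite (F x)" "\<And>x. card (F x) \<le> N" "\<And>x. ball x R \<subseteq> (\<Union>c\<in>F x. ball c r)"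
      using N by metis
    have "\<exists>C. finite C \<and> card C \<le> M * N \<and> ball x (\<rho> + (R - r)) \<subseteq> (\<Union>c\<in>C. ball c r)" for x :: 'a
    proof -
      obtain C where C: "finite C" "card C \<le> M" "ball x \<rho> \<subseteq> (\<Union>c\<in>C. ball c r)"
        using M by blast
      have "card (\<Union>c\<in>C. F c) \<le> (\<Sum>c\<in>C. card (F c))" using C(1) by (rule card_UN_le)
      also have "\<dots> \<le> card C * N" using sum_bounded_above[of C "\<lambda>c. card (F c)" N] F(2) by simp
      also have "\<dots> \<le> M * N" using C(2) by simp
      finally have "card (\<Union>c\<in>C. F c) \<le> M * N" .
      moreover have "y \<in> (\<Union>c\<in>(\<Union>c\<in>C. F c). ball c r)" if "y \<in> ball x (\<rho> + (R - r))" for y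
      proof -
        have y: "dist x y < \<rho> + (R - r)" using that by simp
        obtain g where g: "g 0 = x" "g (dist x y) = y"
            "\<And>s t. \<lbrakk>0 \<le> s; s \<le> dist x y; 0 \<le> t; t \<le> dist x y\<rbrakk> \<Longrightarrow> dist (g s) (g t) = \<bar>s - t\<bar>"
          using geodesic_between_points[OF geod] by blast
        \<comment> \<open>Dividing the segment in the ratio of \<open>\<rho>\<close> to
          \<open>R - r\<close> makes each piece strictly shorter than its share.\<close>
        define s where "s = dist x y * \<rho> / (\<rho> + (R - r))"
        have "s < \<rho>" and s: "0 \<le> s" "s \<le> dist x y" and "dist x y - s < R - r"
        proof -
          have pos: "\<rho> + (R - r) > 0" using \<rho> r by simp
          show "0 \<le> s" unfolding s_def using \<rho> pos by simp
          show "s < \<rho>" unfolding s_def using pos y \<rho> by (simp add: divide_less_eq)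
          show "s \<le> dist x y" unfolding s_def using pos r \<rho>
            by (simp add: divide_le_eq mult_left_mono)
          have "dist x y - s = dist x y * (R - r) / (\<rho> + (R - r))"
            unfolding s_def using pos by (simp add: field_simps)
          also have "\<dots> < R - r" using pos y r by (simp add: divide_less_eq)
          finally show "dist x y - s < R - r" .
        qed
        then have "dist x (g s) < \<rho>" "dist (g s) y < R - r"
          using g(3)[of 0 s] g(3)[of s "dist x y"] g(1,2) by auto
        then obtain c where c: "c \<in> C" "dist c (g s) < r" using C(3) by auto
        then have "dist c y < R"
          using dist_triangle[of c y "g s"] \<open>dist (g s) y < R - r\<close> by simp
        then obtain c' where "c' \<in> F c" "y \<in> ball c' r" using F(3)[of c] by auto
        then show ?thesis using c(1) by blast
      qed
      ultimately show ?thesis using C(1) F(1) by (intro exI[of _ "\<Union>c\<in>C. F c"]) blast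
    qed
    then show ?case by (auto simp: \<rho>_def algebra_simps)
  qed
  show thesis
  proof (rule that[OF r(1)], rule allI)
    fix \<rho> :: real
    obtain k :: nat where "\<rho> / (R - r) < real k" using reals_Archimedean2 by blast
    then have k: "\<rho> \<le> r + real k * (R - r)" using r by (simp add: divide_less_eq)
    obtain M where M: "\<And>x::'a. \<exists>C. finite C \<and> card C \<le> M \<and> ball x (r + real k * (R - r)) \<subseteq> (\<Union>c\<in>C. ball c r)"
      using cover[of k] by blast
    have "card P \<le> M" if P: "finite P" "P \<subseteq> ball x \<rho>"
      "\<forall>y\<in>P. \<forall>z\<in>P. y \<noteq> z \<longrightarrow> 2 * r \<le> dist y z" for x :: 'a and P
    proof -
      obtain C where C: "finite C" "card C \<le> M" "ball x (r + real k * (R - r)) \<subseteq> (\<Union>c\<in>C. ball c r)"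
        using M by blast
      have "P \<subseteq> (\<Union>c\<in>C. ball c r)"
        using P(2) subset_ball[OF k, of x] C(3) by blast
      then have "\<forall>y\<in>P. \<exists>c\<in>C. dist c y < r" by (meson UN_E mem_ball subsetD)
      then obtain f where f: "\<And>y. y \<in> P \<Longrightarrow> f y \<in> C \<and> dist (f y) y < r" by metis
      have "inj_on f P"
      proof (rule inj_onI, rule ccontr)
        fix y z assume yz: "y \<in> P" "z \<in> P" "f y = f z" "y \<noteq> z"
        then have "dist y z < 2 * r"
          using f[of y] f[of z] dist_triangle3[of y z "f y"] by simp
        then show False using P(3) yz by force
      qed
      then have "card P \<le> card C" using f C(1) by (intro card_inj_on_le) auto
      with C(2) show ?thesis by simp
    qed
    then show "\<exists>N. \<forall>(x::'a) P. finite P \<longrightarrow> P \<subseteq> ball x \<rho> \<longrightarrow>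
       (\<forall>y\<in>P. \<forall>z\<in>P. y \<noteq> z \<longrightarrow> 2 * r \<le> dist y z) \<longrightarrow> card P \<le> N" by blast
  qed
qed

subsection \<open>Geodesics to and between boundary points\<close>

locale hyperbolic_geodesic_space =
  fixes \<delta> :: real and X :: "'a::metric_space itself"
  assumes hyp: "delta_hyperbolic \<delta> TYPE('a)"
    and proper: "proper_metric TYPE('a)"
    and geod: "geodesic_metric TYPE('a)"
begin

section \<open>Inequalities for Gromov products and rays\<close>

lemma delta_nonneg: "\<delta> \<ge> 0"
  using hyp by (simp add: delta_hyperbolic_def)

lemma gromov_product_ge:
  fixes w x y z :: 'a
  shows "gromov_product w x y \<ge> min (gromov_product w x z) (gromov_product w z y) - \<delta>"
  using hyp unfolding delta_hyperbolic_def by (metis gromov_product_commute)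

lemma gromov_product_ge2:
  fixes w x y u v :: 'a
  assumes "c \<le> gromov_product w x u" "c \<le> gromov_product w u v" "c \<le> gromov_product w v y"
  shows "c - 2 * \<delta> \<le> gromov_product w x y"
  using gromov_product_ge[of w x u y] gromov_product_ge[of w u v y] assms delta_nonneg
  by linarith

text \<open>Based at \<open>\<tau> 0\<close> the product equals \<open>s\<close>; moving the base
  point to \<open>p\<close> changes it by at most \<open>dist p (\<tau> 0)\<close>.\<close>

lemma gromov_product_ray_ge:
  fixes \<tau> :: "real \<Rightarrow> 'a"
  assumes "geodesic_ray \<tau>" "0 \<le> s" "s \<le> t"
  shows "gromov_product p (\<tau> s) (\<tau> t) \<ge> s - dist p (\<tau> 0)"
proof -
  have "dist (\<tau> s) (\<tau> t) = t - s" "dist (\<tau> 0) (\<tau> t) = t" "dist (\<tau> 0) (\<tau> s) = s"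
    using assms by (simp_all add: geodesic_ray_def)
  then show ?thesis
    using dist_triangle3[of "\<tau> 0" "\<tau> t" p] dist_triangle3[of "\<tau> 0" "\<tau> s" p]
    by (simp add: gromov_product_def)
qed

lemma dist_ray_le:
  fixes \<tau> :: "real \<Rightarrow> 'a"
  assumes "geodesic_ray \<tau>" "0 \<le> t"
  shows "dist p (\<tau> t) \<le> t + dist p (\<tau> 0)"
  using dist_triangle[of p "\<tau> t" "\<tau> 0"] assms by (simp add: geodesic_ray_def)

lemma dist_ray_ge:
  fixes \<tau> :: "real \<Rightarrow> 'a"
  assumes "geodesic_ray \<tau>" "0 \<le> t"
  shows "dist p (\<tau> t) \<ge> t - dist p (\<tau> 0)"
  using dist_triangle3[of "\<tau> 0" "\<tau> t" p] assms by (simp add: geodesic_ray_def)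

text \<open>The ray is a cluster point of geodesics from \<open>p\<close> to the points
  \<open>\<tau> n\<close>. It lies in \<xi> because the products at \<open>p\<close> of
  \<open>g n t\<close> with \<open>\<tau> n\<close> and of \<open>\<tau> n\<close> with
  \<open>\<tau> t\<close> are at least \<open>t - D\<close>, so the \<delta>-inequality bounds
  \<open>dist (g n t) (\<tau> t)\<close> independently of \<open>t\<close> and of large
  \<open>n\<close>.\<close>

lemma ray_from_point_exists:
  fixes p :: 'a
  assumes \<xi>: "\<xi> \<in> gromov_boundary"
  obtains \<gamma> where "\<gamma> \<in> \<xi>" "\<gamma> 0 = p"
proof -
  obtain \<tau> where \<tau>: "\<tau> \<in> \<xi>" using boundary_nonempty[OF \<xi>] by blast
  note ray = boundary_ray[OF \<xi> \<tau>]
  define D where "D = dist p (\<tau> 0)"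
  have "\<forall>n::nat. \<exists>g. g 0 = p \<and> g (dist p (\<tau> n)) = \<tau> n \<and>
    (\<forall>s t. 0 \<le> s \<longrightarrow> s \<le> dist p (\<tau> n) \<longrightarrow> 0 \<le> t \<longrightarrow> t \<le> dist p (\<tau> n) \<longrightarrow> dist (g s) (g t) = \<bar>s - t\<bar>)"
    using geodesic_between_points[OF geod] by metis
  then obtain g where g: "\<And>n::nat. g n 0 = p" "\<And>n. g n (dist p (\<tau> n)) = \<tau> n"
    "\<And>n s t. \<lbrakk>0 \<le> s; s \<le> dist p (\<tau> n); 0 \<le> t; t \<le> dist p (\<tau> n)\<rbrakk> \<Longrightarrow> dist (g n s) (g n t) = \<bar>s - t\<bar>"
    by metis
  \<comment> \<open>Clamping the parameter yields the bound at every real \<open>t\<close> that the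
    compactness argument demands; at a fixed nonnegative \<open>t\<close> it is inactive for large
    \<open>n\<close>.\<close>
  define h where "h n t = g n (min (max 0 t) (dist p (\<tau> n)))" for n :: nat and t :: real
  have "dist p (h n t) \<le> \<bar>t\<bar>" for n t
    using g(3)[of 0 n "min (max 0 t) (dist p (\<tau> n))"] g(1)[of n] by (simp add: h_def)
  then obtain G where
    G: "\<And>s t c. eventually (\<lambda>n. dist (h n s) (h n t) = c) sequentially \<Longrightarrow> dist (G s) (G t) = c"
    "\<And>t q C. eventually (\<lambda>n. dist (h n t) q \<le> C) sequentially \<Longrightarrow> dist (G t) q \<le> C"
    using pointwise_cluster_point[OF proper] by blast
  have large: "eventually (\<lambda>n. t \<le> dist p (\<tau> (real n)) \<and> t \<le> real n) sequentially" for t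
  proof -
    have "eventually (\<lambda>n. t + D \<le> real n) sequentially"
      using filterlim_real_sequentially by (simp add: filterlim_at_top)
    then show ?thesis
    proof eventually_elim
      case (elim n)
      then show ?case
        using dist_ray_ge[OF ray, of n p] zero_le_dist[of p "\<tau> 0"] unfolding D_def by linarith
    qed
  qed
  have h_eq: "h n t = g n t" if "0 \<le> t" "t \<le> dist p (\<tau> n)" for n t
    using that by (simp add: h_def)
  have "dist (G 0) p \<le> 0"
    by (rule G(2)) (simp add: h_def g)
  moreover have G_ray: "geodesic_ray G"
    unfolding geodesic_ray_def
  proof (intro allI impI)
    fix s t :: real assume st: "0 \<le> s" "0 \<le> t"
    show "dist (G s) (G t) = \<bar>s - t\<bar>"
    proof (rule G(1))
      show "eventually (\<lambda>n. dist (h n s) (h n t) = \<bar>s - t\<bar>) sequentially"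
        using large[of s] large[of t] by eventually_elim (use st g(3) h_eq in simp)
    qed
  qed
  moreover have "dist (G t) (\<tau> t) \<le> 3 * D + 2 * \<delta>" if t: "0 \<le> t" for t
  proof (rule G(2))
    show "eventually (\<lambda>n. dist (h n t) (\<tau> t) \<le> 3 * D + 2 * \<delta>) sequentially"
      using large[of t]
    proof eventually_elim
      case (elim n)
      let ?z = "\<tau> (real n)"
      have ht: "h n t = g n t" using elim h_eq t by simp
      have 1: "dist p (g n t) = t" using g(3)[of 0 n t] elim t g(1)[of n] by simp
      have 2: "dist (g n t) ?z = dist p ?z - t"
        using g(3)[of t n "dist p ?z"] elim t g(2)[of n] by simp
      have 3: "gromov_product p (\<tau> t) ?z \<ge> t - D"
        using gromov_product_ray_ge[OF ray t, of n] elim by (simp add: D_def)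
      have 4: "gromov_product p (g n t) ?z = t"
        using 1 2 by (simp add: gromov_product_def)
      have "gromov_product p (g n t) (\<tau> t) \<ge> t - D - \<delta>"
        using gromov_product_ge[of p "g n t" ?z "\<tau> t"] 3 4 zero_le_dist[of p "\<tau> 0"]
        unfolding gromov_product_commute[of p ?z] D_def by linarith
      then show ?case
        using dist_ray_le[OF ray t, of p] 1 unfolding ht by (simp add: gromov_product_def D_def)
    qed
  qed
  ultimately have "(\<tau>, G) \<in> asymp_rays"
    using ray by (auto simp: asymp_rays_def dist_commute)
  then have "G \<in> \<xi>" using boundary_closed \<xi> \<tau> by blast
  then show thesis using that \<open>dist (G 0) p \<le> 0\<close> by simp
qed

text \<open>Take a time \<open>u\<close> at which the rays are far apart. A product above
  \<open>u + D\<close> would force \<open>u \<le> s\<close> and \<open>u \<le> t\<close>, and the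
  chain \<open>\<gamma> u\<close>, \<open>\<gamma> s\<close>, \<open>\<tau> t\<close>,
  \<open>\<tau> u\<close> would have consecutive products at least \<open>u - D\<close>, bringing
  the rays close at time \<open>u\<close>.\<close>

lemma not_asymp_gromov_product_bounded:
  fixes \<gamma> \<tau> :: "real \<Rightarrow> 'a"
  assumes \<gamma>: "geodesic_ray \<gamma>" "\<gamma> 0 = p" and \<tau>: "geodesic_ray \<tau>" and na: "(\<gamma>, \<tau>) \<notin> asymp_rays"
  obtains M where "\<And>s t. \<lbrakk>0 \<le> s; 0 \<le> t\<rbrakk> \<Longrightarrow> gromov_product p (\<gamma> s) (\<tau> t) \<le> M"
proof -
  define D where "D = dist p (\<tau> 0)"
  have "\<not> (\<forall>u\<ge>0. dist (\<gamma> u) (\<tau> u) \<le> 3 * D + 4 * \<delta>)"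
    using na \<gamma> \<tau> by (auto simp: asymp_rays_def)
  then obtain u where u: "u \<ge> 0" "dist (\<gamma> u) (\<tau> u) > 3 * D + 4 * \<delta>" by force
  have p\<gamma>: "dist p (\<gamma> s) = s" if "s \<ge> 0" for s
    using \<gamma> that by (auto simp: geodesic_ray_def)
  have "gromov_product p (\<gamma> s) (\<tau> t) \<le> u + D" if st: "0 \<le> s" "0 \<le> t" for s t
  proof (rule ccontr)
    assume neg: "\<not> ?thesis"
    have "gromov_product p (\<gamma> s) (\<tau> t) \<le> s"
      using dist_triangle[of p "\<tau> t" "\<gamma> s"] p\<gamma>[OF st(1)] by (simp add: gromov_product_def)
    then have us: "u \<le> s" using neg by (simp add: D_def) (smt (verit) zero_le_dist)
    have "gromov_product p (\<gamma> s) (\<tau> t) \<le> t + D"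
      using dist_triangle[of p "\<gamma> s" "\<tau> t"] dist_ray_le[OF \<tau> st(2), of p]
      by (simp add: gromov_product_def D_def dist_commute)
    then have ut: "u \<le> t" using neg by simp
    have "gromov_product p (\<gamma> u) (\<gamma> s) \<ge> u - D"
      using gromov_product_ray_ge[OF \<gamma>(1) u(1) us, of p] \<gamma>(2) by (simp add: D_def) (smt (verit) zero_le_dist)
    moreover have "gromov_product p (\<tau> t) (\<tau> u) \<ge> u - D"
      using gromov_product_ray_ge[OF \<tau> u(1) ut, of p] by (simp add: gromov_product_commute D_def)
    moreover have "gromov_product p (\<gamma> s) (\<tau> t) \<ge> u - D"
      using neg by (simp add: D_def) (smt (verit) zero_le_dist)
    ultimately have "gromov_product p (\<gamma> u) (\<tau> u) \<ge> u - D - 2 * \<delta>"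
      by (intro gromov_product_ge2)
    then have "dist (\<gamma> u) (\<tau> u) \<le> 3 * D + 4 * \<delta>"
      using dist_ray_le[OF \<tau> u(1), of p] p\<gamma>[OF u(1)] by (simp add: gromov_product_def D_def)
    then show False using u(2) by simp
  qed
  then show thesis by (rule that)
qed

text \<open>This is the \<delta>-inequality for \<open>a\<close> and \<open>c\<close> through
  \<open>x\<close>, written in distances. It serves to locate a point \<open>x\<close> on a geodesic
  from \<open>a\<close> to \<open>c\<close>, where the distances to the ends are known.\<close>

lemma four_point:
  fixes w x a c :: 'a
  shows "dist w x + dist a c \<le> max (dist w a + dist x c) (dist w c + dist x a) + 2 * \<delta>"
  using gromov_product_ge[of w a x c]
  by (simp add: gromov_product_def dist_commute field_simps min_def max_def split: if_splits)

text \<open>The bi-infinite geodesic is a cluster point of geodesics joining far points of two rays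
  from a common origin, parametrised from their midpoints: these stay in a bounded region
  because the Gromov products along the two rays are bounded.\<close>

lemma bi_geodesic_exists:
  fixes \<eta>1 \<eta>2 :: "(real \<Rightarrow> 'a) set"
  assumes \<eta>: "\<eta>1 \<in> gromov_boundary" "\<eta>2 \<in> gromov_boundary" "\<eta>1 \<noteq> \<eta>2"
  obtains \<sigma> where "geodesic_between \<eta>1 \<eta>2 \<sigma>"
proof -
  obtain p :: 'a where True by simp
  obtain \<tau>1 where \<tau>1: "\<tau>1 \<in> \<eta>1" "\<tau>1 0 = p" using ray_from_point_exists[OF \<eta>(1)] by blast
  obtain \<tau>2 where \<tau>2: "\<tau>2 \<in> \<eta>2" "\<tau>2 0 = p" using ray_from_point_exists[OF \<eta>(2)] by blast
  note ray1 = boundary_ray[OF \<eta>(1) \<tau>1(1)] and ray2 = boundary_ray[OF \<eta>(2) \<tau>2(1)]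
  have "(\<tau>1, \<tau>2) \<notin> asymp_rays"
    using boundary_not_asymp[OF \<eta>(2,1) _ \<tau>2(1) \<tau>1(1)] \<eta>(3) by blast
  then obtain M where M: "\<And>s t. \<lbrakk>0 \<le> s; 0 \<le> t\<rbrakk> \<Longrightarrow> gromov_product p (\<tau>1 s) (\<tau>2 t) \<le> M"
    using not_asymp_gromov_product_bounded[OF ray1 \<tau>1(2) ray2] by blast
  have p1: "dist p (\<tau>1 s) = s" and p2: "dist p (\<tau>2 s) = s" if "s \<ge> 0" for s
    using ray1 ray2 \<tau>1(2) \<tau>2(2) that by (auto simp: geodesic_ray_def)
  \<comment> \<open>Half the length of the segment, so that the midpoint gets parameter 0; the bound
    \<open>n - M \<le> l n\<close> makes the parameter intervals exhaust the line.\<close>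
  define l where "l n = dist (\<tau>1 (real n)) (\<tau>2 (real n)) / 2" for n :: nat
  have l: "0 \<le> l n" "l n \<le> n" "n - M \<le> l n" for n
    using M[of n n] dist_triangle3[of "\<tau>1 n" "\<tau>2 n" p] p1[of n] p2[of n]
    by (auto simp: l_def gromov_product_def)
  have "\<forall>n::nat. \<exists>g. g (- l n) = \<tau>1 n \<and> g (l n) = \<tau>2 n \<and>
    (\<forall>s t. - l n \<le> s \<longrightarrow> s \<le> l n \<longrightarrow> - l n \<le> t \<longrightarrow> t \<le> l n \<longrightarrow> dist (g s) (g t) = \<bar>s - t\<bar>)"
  proof
    fix n :: nat
    obtain g where g: "g 0 = \<tau>1 n" "g (2 * l n) = \<tau>2 n"
      "\<And>s t. \<lbrakk>0 \<le> s; s \<le> 2 * l n; 0 \<le> t; t \<le> 2 * l n\<rbrakk> \<Longrightarrow> dist (g s) (g t) = \<bar>s - t\<bar>"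
      using geodesic_between_points[OF geod, of "\<tau>1 n" "\<tau>2 n"] by (auto simp: l_def)
    show "\<exists>g. g (- l n) = \<tau>1 n \<and> g (l n) = \<tau>2 n \<and>
      (\<forall>s t. - l n \<le> s \<longrightarrow> s \<le> l n \<longrightarrow> - l n \<le> t \<longrightarrow> t \<le> l n \<longrightarrow> dist (g s) (g t) = \<bar>s - t\<bar>)"
      by (rule exI[of _ "\<lambda>t. g (t + l n)"]) (use g in auto)
  qed
  then obtain g where g: "\<And>n::nat. g n (- l n) = \<tau>1 n" "\<And>n. g n (l n) = \<tau>2 n"
    "\<And>n s t. \<lbrakk>- l n \<le> s; s \<le> l n; - l n \<le> t; t \<le> l n\<rbrakk> \<Longrightarrow> dist (g n s) (g n t) = \<bar>s - t\<bar>"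
    by metis
  define D where "D = M + 2 * \<delta>"
  \<comment> \<open>For the midpoint both terms of the maximum in \<open>four_point\<close> equal
    \<open>n + l n\<close>, which leaves
    \<open>dist p (g n 0) \<le> n - l n + 2 * \<delta>\<close>.\<close>
  have mid: "dist p (g n 0) \<le> D" for n
    using four_point[of p "g n 0" "\<tau>1 n" "\<tau>2 n"] M[of n n] p1[of n] p2[of n]
      g(3)[of n 0 "l n"] g(3)[of n 0 "- l n"] g(1,2)[of n] l[of n]
    by (simp add: gromov_product_def D_def l_def)
  define h where "h n t = g n (max (- l n) (min t (l n)))" for n :: nat and t :: real
  have "dist p (h n t) \<le> D + \<bar>t\<bar>" for n t
  proof -
    have "\<bar>max (- l n) (min t (l n))\<bar> \<le> \<bar>t\<bar>" using l(1)[of n] by linarith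
    then show ?thesis
      using dist_triangle[of p "h n t" "g n 0"] mid[of n]
        g(3)[of n 0 "max (- l n) (min t (l n))"] l[of n] by (simp add: h_def)
  qed
  then obtain G where
    G: "\<And>s t c. eventually (\<lambda>n. dist (h n s) (h n t) = c) sequentially \<Longrightarrow> dist (G s) (G t) = c"
    "\<And>t q C. eventually (\<lambda>n. dist (h n t) q \<le> C) sequentially \<Longrightarrow> dist (G t) q \<le> C"
    using pointwise_cluster_point[OF proper, of p h "\<lambda>t. D + \<bar>t\<bar>"] by blast
  have large: "eventually (\<lambda>n. \<bar>t\<bar> \<le> l n) sequentially" for t
  proof -
    have "eventually (\<lambda>n. \<bar>t\<bar> + M \<le> real n) sequentially"
      using filterlim_real_sequentially by (simp add: filterlim_at_top)
    then show ?thesis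
      by eventually_elim (use l(3) in \<open>smt (verit)\<close>)
  qed
  have h_eq: "h n t = g n t" if "\<bar>t\<bar> \<le> l n" for n t
    using that by (simp add: h_def)
  have bi: "bi_geodesic G"
    unfolding bi_geodesic_def
  proof (intro allI)
    fix s t :: real
    show "dist (G s) (G t) = \<bar>s - t\<bar>"
    proof (rule G(1))
      show "eventually (\<lambda>n. dist (h n s) (h n t) = \<bar>s - t\<bar>) sequentially"
        using large[of s] large[of t] by eventually_elim (use g(3) h_eq in simp)
    qed
  qed
  \<comment> \<open>The cases \<open>u = t\<close> and \<open>u = - t\<close> treat both halves at
    once. As the midpoint is within \<open>D\<close> of \<open>p\<close>, the product of
    \<open>g n u\<close> with \<open>\<tau> n\<close> is at least \<open>t - D / 2\<close>; that of
    \<open>\<tau> t\<close> with \<open>\<tau> n\<close> is at least \<open>t\<close>.\<close>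
  have fellow: "dist (g n u) (\<tau> t) \<le> 2 * D + 2 * \<delta>"
    if t: "0 \<le> t" "\<bar>u\<bar> = t" "t \<le> l n" and \<tau>: "geodesic_ray \<tau>" "\<tau> 0 = p"
      and tip: "dist (g n u) (\<tau> n) = l n - t" for n t u \<tau>
  proof -
    have p\<tau>: "dist p (\<tau> s) = s" if "s \<ge> 0" for s
      using \<tau> that by (auto simp: geodesic_ray_def)
    have ug: "dist (g n u) (g n 0) = t" using g(3)[of n u 0] t by (simp add: abs_le_iff)
    have "gromov_product p (g n u) (\<tau> n) \<ge> t - D / 2"
      using tip dist_triangle3[of "g n u" "g n 0" p] ug mid[of n] l(2)[of n] p\<tau>[of n]
      by (simp add: gromov_product_def)
    moreover have "gromov_product p (\<tau> t) (\<tau> n) \<ge> t"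
      using gromov_product_ray_ge[OF \<tau>(1) t(1), of n p] t l(2)[of n] \<tau>(2) by simp
    moreover have "D \<ge> 0" using mid[of n] zero_le_dist order_trans by blast
    ultimately have "gromov_product p (g n u) (\<tau> t) \<ge> t - D / 2 - \<delta>"
      using gromov_product_ge[of p "g n u" "\<tau> n" "\<tau> t"]
      by (simp add: gromov_product_commute[of p "\<tau> n"] min_def split: if_splits)
    moreover have "dist p (g n u) \<le> t + D"
      using dist_triangle[of p "g n u" "g n 0"] ug mid[of n] by (simp add: dist_commute)
    ultimately show ?thesis
      using p\<tau>[OF t(1)] by (simp add: gromov_product_def)
  qed
  have "dist (G t) (\<tau>2 t) \<le> 2 * D + 2 * \<delta>" if t: "t \<ge> 0" for t
  proof (rule G(2))
    show "eventually (\<lambda>n. dist (h n t) (\<tau>2 t) \<le> 2 * D + 2 * \<delta>) sequentially"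
      using large[of t]
    proof eventually_elim
      case (elim n)
      have "dist (g n t) (\<tau>2 n) = l n - t" using g(3)[of n t "l n"] elim t g(2)[of n] by simp
      then show ?case using fellow[of t t n \<tau>2] elim t h_eq ray2 \<tau>2(2) by simp
    qed
  qed
  then have "(\<tau>2, G) \<in> asymp_rays"
    using ray2 bi by (auto simp: asymp_rays_def dist_commute geodesic_ray_def bi_geodesic_def)
  moreover have "dist (G (- t)) (\<tau>1 t) \<le> 2 * D + 2 * \<delta>" if t: "t \<ge> 0" for t
  proof (rule G(2))
    show "eventually (\<lambda>n. dist (h n (- t)) (\<tau>1 t) \<le> 2 * D + 2 * \<delta>) sequentially"
      using large[of t]
    proof eventually_elim
      case (elim n)
      have "dist (g n (- t)) (\<tau>1 n) = l n - t" using g(3)[of n "- t" "- l n"] elim t g(1)[of n] by simp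
      then show ?case using fellow[of t "- t" n \<tau>1] elim t h_eq ray1 \<tau>1(2) by simp
    qed
  qed
  then have "(\<tau>1, \<lambda>t. G (- t)) \<in> asymp_rays"
    using ray1 bi by (auto simp: asymp_rays_def dist_commute geodesic_ray_def bi_geodesic_def)
  ultimately have "geodesic_between \<eta>1 \<eta>2 G"
    using bi boundary_closed[OF \<eta>(1) \<tau>1(1)] boundary_closed[OF \<eta>(2) \<tau>2(1)]
    by (simp add: geodesic_between_def)
  then show thesis by (rule that)
qed

text \<open>The witnesses lie on the geodesics from \<open>w\<close> to the points \<open>a i\<close>, at distance \<open>s\<close>
  from \<open>w\<close>; the common centre lies at distance \<open>s0\<close> on the geodesic to \<open>a0\<close>.\<close>

lemma separated_points_in_ball:
  fixes w a0 :: 'a and a :: "'i \<Rightarrow> 'a"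
  assumes s: "0 \<le> s0" "s0 \<le> s" and r: "0 < r"
    and a0: "s0 \<le> dist w a0" and far: "\<And>i. i \<in> I \<Longrightarrow> s \<le> dist w (a i)"
    and near: "\<And>i. i \<in> I \<Longrightarrow> s0 \<le> gromov_product w (a i) a0"
    and sep: "\<And>i j. \<lbrakk>i \<in> I; j \<in> I; i \<noteq> j\<rbrakk> \<Longrightarrow> gromov_product w (a i) (a j) \<le> s - r - 2 * \<delta>"
  obtains x :: 'a and y where "\<And>i. i \<in> I \<Longrightarrow> dist x (y i) \<le> s - s0 + 4 * \<delta>"
    "\<And>i j. \<lbrakk>i \<in> I; j \<in> I; i \<noteq> j\<rbrakk> \<Longrightarrow> 2 * r \<le> dist (y i) (y j)"
proof -
  have "\<forall>z. \<exists>g. g 0 = w \<and> g (dist w z) = z \<and>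
    (\<forall>s t. 0 \<le> s \<longrightarrow> s \<le> dist w z \<longrightarrow> 0 \<le> t \<longrightarrow> t \<le> dist w z \<longrightarrow> dist (g s) (g t) = \<bar>s - t\<bar>)"
    using geodesic_between_points[OF geod] by metis
  then obtain g where g: "\<And>z. g z 0 = w" "\<And>z. g z (dist w z) = z"
    "\<And>z s t. \<lbrakk>0 \<le> s; s \<le> dist w z; 0 \<le> t; t \<le> dist w z\<rbrakk> \<Longrightarrow> dist (g z s) (g z t) = \<bar>s - t\<bar>"
    by metis
  have wg: "dist w (g z t) = t" and gp: "gromov_product w (g z t) z = t"
    if "0 \<le> t" "t \<le> dist w z" for z t
    using g(3)[of 0 z t] g(3)[of t z "dist w z"] g(1,2)[of z] that
    by (auto simp: gromov_product_def)
  show thesis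
  proof (rule that[of "g a0 s0" "\<lambda>i. g (a i) s"])
    fix i assume i: "i \<in> I"
    \<comment> \<open>The chain goes out along one geodesic to \<open>a0\<close>, across to
      \<open>a i\<close> and back along the other; each of its three products is at least
      \<open>s0\<close>.\<close>
    have "gromov_product w (g a0 s0) (g (a i) s0) \<ge> s0 - 2 * \<delta>"
      using gromov_product_ge2[of s0 w "g a0 s0" a0 "a i" "g (a i) s0"] gp[of s0 a0] gp[of s0 "a i"]
        near[OF i] far[OF i] s a0 by (simp add: gromov_product_commute)
    then have "dist (g a0 s0) (g (a i) s0) \<le> 4 * \<delta>"
      using wg[of s0 a0] wg[of s0 "a i"] far[OF i] s a0 by (simp add: gromov_product_def)
    moreover have "dist (g (a i) s0) (g (a i) s) = s - s0"
      using g(3)[of s0 "a i" s] far[OF i] s by simp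
    ultimately show "dist (g a0 s0) (g (a i) s) \<le> s - s0 + 4 * \<delta>"
      using dist_triangle[of "g a0 s0" "g (a i) s" "g (a i) s0"] by simp
  next
    fix i j assume ij: "i \<in> I" "j \<in> I" "i \<noteq> j"
    \<comment> \<open>The cap \<open>s\<close> is the product of each end point with its witness, so
      all three products of the chain are at least \<open>c\<close>. As \<open>r > 0\<close>, the
      bound \<open>c \<le> s - r\<close> then shows that the minimum is not the cap.\<close>
    define c where "c = min s (gromov_product w (g (a i) s) (g (a j) s))"
    have "c - 2 * \<delta> \<le> gromov_product w (a i) (a j)"
      using gromov_product_ge2[of c w "a i" "g (a i) s" "g (a j) s" "a j"]
        gp[of s "a i"] gp[of s "a j"] far[OF ij(1)] far[OF ij(2)] s
      by (simp add: gromov_product_commute[of w "a i"] c_def)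
    then have "c \<le> s - r" using sep[OF ij] by simp
    then have "gromov_product w (g (a i) s) (g (a j) s) \<le> s - r"
      using r by (simp add: c_def min_def split: if_splits)
    then show "2 * r \<le> dist (g (a i) s) (g (a j) s)"
      using wg[of s "a i"] wg[of s "a j"] far[OF ij(1)] far[OF ij(2)] s
      by (simp add: gromov_product_def)
  qed
qed

end

subsection \<open>Heights relative to a boundary point\<close>

locale hyperbolic_space_ray = hyperbolic_geodesic_space \<delta> X
  for \<delta> :: real and X :: "'a::metric_space itself" +
  fixes \<xi> :: "(real \<Rightarrow> 'a) set" and p :: 'a and \<gamma> :: "real \<Rightarrow> 'a"
  assumes xi: "\<xi> \<in> gromov_boundary" and gamma: "\<gamma> \<in> \<xi>" "\<gamma> 0 = p"
begin

abbreviation b :: "'a \<Rightarrow> real" where "b \<equiv> busemann_ray \<gamma>"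

text \<open>The Gromov product with base point moved to \<open>\<xi>\<close> along \<open>\<gamma>\<close>, renormalised.\<close>

definition horo_product :: "'a \<Rightarrow> 'a \<Rightarrow> real" where
  "horo_product x y = (b x + b y - dist x y) / 2"

lemma horo_product_commute: "horo_product x y = horo_product y x"
  by (simp add: horo_product_def dist_commute)

section \<open>Limits of distances and products along \<gamma>\<close>

lemma ray_gamma: "geodesic_ray \<gamma>"
  using boundary_ray[OF xi gamma(1)] .

lemma tendsto_b: "((\<lambda>t. dist (\<gamma> t) x - t) \<longlongrightarrow> b x) at_top"
  by (rule tendsto_busemann_ray[OF ray_gamma])

lemma b_lipschitz: "b x \<le> b y + dist x y"
proof (rule tendsto_le[OF _ tendsto_add[OF tendsto_b tendsto_const] tendsto_b])
  show "eventually (\<lambda>t. dist (\<gamma> t) x - t \<le> dist (\<gamma> t) y - t + dist x y) at_top"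
    by (rule always_eventually) (smt (verit) dist_commute dist_triangle)
qed simp

lemma tendsto_horo_product:
  "((\<lambda>t. gromov_product (\<gamma> t) x y - t) \<longlongrightarrow> horo_product x y) at_top"
proof -
  have eq: "gromov_product (\<gamma> t) x y - t = ((dist (\<gamma> t) x - t) + (dist (\<gamma> t) y - t) - dist x y) / 2" for t
    by (simp add: gromov_product_def field_simps)
  show ?thesis unfolding horo_product_def eq
    by (intro tendsto_divide tendsto_diff tendsto_add tendsto_b tendsto_const) simp
qed

lemma horo_product_ge: "horo_product x y \<ge> min (horo_product x z) (horo_product z y) - \<delta>"
proof (rule tendsto_le[OF _ tendsto_horo_product])
  show "((\<lambda>t. min (gromov_product (\<gamma> t) x z - t) (gromov_product (\<gamma> t) z y - t) - \<delta>)
    \<longlongrightarrow> min (horo_product x z) (horo_product z y) - \<delta>) at_top"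
    by (intro tendsto_diff tendsto_min tendsto_horo_product tendsto_const)
  show "eventually (\<lambda>t. min (gromov_product (\<gamma> t) x z - t) (gromov_product (\<gamma> t) z y - t) - \<delta>
     \<le> gromov_product (\<gamma> t) x y - t) at_top"
  proof (rule always_eventually, rule allI)
    fix t show "min (gromov_product (\<gamma> t) x z - t) (gromov_product (\<gamma> t) z y - t) - \<delta>
     \<le> gromov_product (\<gamma> t) x y - t"
      using gromov_product_ge[of "\<gamma> t" x z y] by linarith
  qed
qed simp

lemma horo_product_ge2:
  assumes "c \<le> horo_product x u" "c \<le> horo_product u v" "c \<le> horo_product v y"
  shows "c - 2 * \<delta> \<le> horo_product x y"
  using horo_product_ge[of x u y] horo_product_ge[of u v y] assms delta_nonneg
  by linarith

text \<open>Two rays from \<open>p\<close> in the same class stay within \<open>4 * \<delta>\<close>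
  of each other, however large their asymptoticity constant \<open>C\<close>: at time
  \<open>t + C\<close> their product is at least \<open>t + C / 2\<close>, and a chain of three
  products brings this back to time \<open>t\<close>.\<close>

lemma busemann_ray_diff_le:
  assumes "\<gamma>' \<in> \<xi>" "\<gamma>' 0 = p"
  shows "busemann_ray \<gamma>' x \<le> b x + 4 * \<delta>"
proof -
  note ray' = boundary_ray[OF xi assms(1)]
  obtain C where C: "\<And>t. t \<ge> 0 \<Longrightarrow> dist (\<gamma> t) (\<gamma>' t) \<le> C"
    using boundary_asymp[OF xi gamma(1) assms(1)] by (auto simp: asymp_rays_def)
  have "C \<ge> 0" using C[of 0] zero_le_dist[of "\<gamma> 0" "\<gamma>' 0"] by linarith
  have close: "dist (\<gamma> t) (\<gamma>' t) \<le> 4 * \<delta>" if t: "t \<ge> 0" for t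
  proof -
    define T where "T = t + C"
    have T: "T \<ge> 0" "t \<le> T" using t \<open>C \<ge> 0\<close> by (auto simp: T_def)
    have d: "dist p (\<gamma> u) = u" "dist p (\<gamma>' u) = u" if "u \<ge> 0" for u
      using ray_gamma ray' gamma(2) assms(2) that by (auto simp: geodesic_ray_def)
    have "t \<le> gromov_product p (\<gamma> t) (\<gamma> T)"
      using gromov_product_ray_ge[OF ray_gamma t T(2), of p] gamma(2) by simp
    moreover have "t \<le> gromov_product p (\<gamma>' T) (\<gamma>' t)"
      using gromov_product_ray_ge[OF ray' t T(2), of p] assms(2) by (simp add: gromov_product_commute)
    moreover have "t \<le> gromov_product p (\<gamma> T) (\<gamma>' T)"
      using d[OF T(1)] C[OF T(1)] \<open>C \<ge> 0\<close> by (simp add: gromov_product_def T_def)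
    ultimately have "t - 2 * \<delta> \<le> gromov_product p (\<gamma> t) (\<gamma>' t)"
      by (intro gromov_product_ge2)
    then show ?thesis using d[OF t] by (simp add: gromov_product_def)
  qed
  show ?thesis
  proof (rule tendsto_le[OF _ tendsto_add[OF tendsto_b tendsto_const] tendsto_busemann_ray[OF ray']])
    show "eventually (\<lambda>t. dist (\<gamma>' t) x - t \<le> dist (\<gamma> t) x - t + 4 * \<delta>) at_top"
      using eventually_ge_at_top[of 0]
    proof eventually_elim
      case (elim t)
      then show ?case using close[of t] dist_triangle[of "\<gamma>' t" x "\<gamma> t"] by (simp add: dist_commute)
    qed
  qed simp
qed

text \<open>These bounds replace the supremum over all rays by the single function \<open>b\<close>,
  which inherits inequalities from the finite base points \<open>\<gamma> t\<close>.\<close>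

lemma busemann_bounds: "b x \<le> busemann \<xi> p x" "busemann \<xi> p x \<le> b x + 4 * \<delta>"
proof -
  let ?S = "{busemann_ray \<gamma>' x |\<gamma>'. \<gamma>' \<in> \<xi> \<and> \<gamma>' 0 = p}"
  have mem: "b x \<in> ?S" using gamma by blast
  have le: "y \<le> b x + 4 * \<delta>" if "y \<in> ?S" for y
    using that busemann_ray_diff_le by blast
  show "b x \<le> busemann \<xi> p x"
    unfolding busemann_def by (rule cSup_upper[OF mem bdd_aboveI]) (rule le)
  show "busemann \<xi> p x \<le> b x + 4 * \<delta>"
    unfolding busemann_def by (rule cSup_least) (use mem le in auto)
qed

text \<open>Products bounded by \<open>M\<close> mean that
  \<open>dist (\<gamma> s) (\<tau> t)\<close> is at least
  \<open>s + dist p (\<tau> t) - 2 * M\<close>; the summand \<open>s\<close> cancels in the Busemann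
  limit.\<close>

lemma b_along_ray_ge:
  assumes \<eta>: "\<eta> \<in> gromov_boundary" "\<eta> \<noteq> \<xi>" "\<tau> \<in> \<eta>"
  obtains K where "\<And>t. t \<ge> 0 \<Longrightarrow> t - K \<le> b (\<tau> t)"
proof -
  note ray = boundary_ray[OF \<eta>(1,3)]
  have "(\<gamma>, \<tau>) \<notin> asymp_rays" using boundary_not_asymp[OF \<eta>(1) xi \<eta>(2,3) gamma(1)] .
  then obtain M where M: "\<And>s t. \<lbrakk>0 \<le> s; 0 \<le> t\<rbrakk> \<Longrightarrow> gromov_product p (\<gamma> s) (\<tau> t) \<le> M"
    using not_asymp_gromov_product_bounded[OF ray_gamma gamma(2) ray] by blast
  have "t - (dist p (\<tau> 0) + 2 * M) \<le> b (\<tau> t)" if t: "t \<ge> 0" for t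
  proof (rule tendsto_lowerbound[OF tendsto_b])
    show "eventually (\<lambda>s. t - (dist p (\<tau> 0) + 2 * M) \<le> dist (\<gamma> s) (\<tau> t) - s) at_top"
      using eventually_ge_at_top[of 0]
    proof eventually_elim
      case (elim s)
      have "dist p (\<gamma> s) = s" using ray_gamma gamma(2) elim by (auto simp: geodesic_ray_def)
      then show ?case
        using M[OF elim t] dist_ray_ge[OF ray t, of p] by (simp add: gromov_product_def)
    qed
  qed simp
  then show thesis by (rule that)
qed

lemma b_along_ray_at_top:
  assumes "\<eta> \<in> gromov_boundary" "\<eta> \<noteq> \<xi>" "\<tau> \<in> \<eta>"
  shows "eventually (\<lambda>t. c \<le> b (\<tau> t)) at_top"
proof -
  obtain K where K: "\<And>t. t \<ge> 0 \<Longrightarrow> t - K \<le> b (\<tau> t)" using b_along_ray_ge[OF assms] by blast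
  show ?thesis using eventually_ge_at_top[of "max 0 (c + K)"]
  proof eventually_elim
    case (elim t)
    then show ?case using K[of t] by simp
  qed
qed

text \<open>Both values of \<open>b\<close> tend to infinity while the distance stays bounded. This
  stands for an infinite product of \<eta> with itself and permits exchanging rays of one
  class.\<close>

lemma horo_product_asymp_at_top:
  assumes \<eta>: "\<eta> \<in> gromov_boundary" "\<eta> \<noteq> \<xi>" and \<tau>: "\<tau> \<in> \<eta>" "\<tau>' \<in> \<eta>"
  shows "eventually (\<lambda>t. c \<le> horo_product (\<tau> t) (\<tau>' t)) at_top"
proof -
  obtain C where C: "\<And>t. t \<ge> 0 \<Longrightarrow> dist (\<tau> t) (\<tau>' t) \<le> C"
    using boundary_asymp[OF \<eta>(1) \<tau>] by (auto simp: asymp_rays_def)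
  show ?thesis
    using eventually_ge_at_top[of 0] b_along_ray_at_top[OF \<eta> \<tau>(1), of "c + C / 2"]
      b_along_ray_at_top[OF \<eta> \<tau>(2), of "c + C / 2"]
  proof eventually_elim
    case (elim t)
    then show ?case using C[of t] by (simp add: horo_product_def)
  qed
qed

text \<open>Add the Lipschitz bounds between \<open>\<sigma> u\<close> and the two ends: the
  distances from \<open>\<sigma> u\<close> sum to the distance between the ends.\<close>

lemma horo_product_le_b:
  assumes "bi_geodesic \<sigma>" "\<bar>u\<bar> \<le> t"
  shows "horo_product (\<sigma> (- t)) (\<sigma> t) \<le> b (\<sigma> u)"
proof -
  have "dist (\<sigma> (- t)) (\<sigma> t) = 2 * t" "dist (\<sigma> (- t)) (\<sigma> u) = u + t" "dist (\<sigma> t) (\<sigma> u) = t - u"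
    using assms by (auto simp: bi_geodesic_def)
  then show ?thesis
    using b_lipschitz[of "\<sigma> (- t)" "\<sigma> u"] b_lipschitz[of "\<sigma> t" "\<sigma> u"] by (simp add: horo_product_def)
qed

text \<open>At the point of the segment where the two terms of the maximum agree, the four-point
  inequality with one vertex sent to \<open>\<xi>\<close> bounds \<open>b\<close> by the product of the end points.\<close>

lemma exists_b_le_horo_product:
  assumes \<sigma>: "bi_geodesic \<sigma>" and t: "t \<ge> 0"
  obtains u where "b (\<sigma> u) \<le> horo_product (\<sigma> (- t)) (\<sigma> t) + 2 * \<delta>"
proof -
  let ?a = "\<sigma> (- t)" and ?c = "\<sigma> t"
  define u where "u = (b ?a - b ?c) / 2"
  have ac: "dist ?a ?c = 2 * t" using \<sigma> t by (simp add: bi_geodesic_def)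
  have "\<bar>u\<bar> \<le> t"
    using b_lipschitz[of ?a ?c] b_lipschitz[of ?c ?a] ac by (simp add: u_def dist_commute abs_le_iff)
  then have d: "dist (\<sigma> u) ?a = u + t" "dist (\<sigma> u) ?c = t - u"
    using \<sigma> by (auto simp: bi_geodesic_def)
  have "b (\<sigma> u) + dist ?a ?c \<le> max (b ?a + dist (\<sigma> u) ?c) (b ?c + dist (\<sigma> u) ?a) + 2 * \<delta>"
  proof (rule tendsto_le)
    show "((\<lambda>s. dist (\<gamma> s) (\<sigma> u) - s + dist ?a ?c) \<longlongrightarrow> b (\<sigma> u) + dist ?a ?c) at_top"
      by (intro tendsto_add tendsto_b tendsto_const)
    show "((\<lambda>s. max (dist (\<gamma> s) ?a - s + dist (\<sigma> u) ?c) (dist (\<gamma> s) ?c - s + dist (\<sigma> u) ?a) + 2 * \<delta>)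
      \<longlongrightarrow> max (b ?a + dist (\<sigma> u) ?c) (b ?c + dist (\<sigma> u) ?a) + 2 * \<delta>) at_top"
      by (intro tendsto_add tendsto_max tendsto_b tendsto_const)
    show "eventually (\<lambda>s. dist (\<gamma> s) (\<sigma> u) - s + dist ?a ?c \<le>
      max (dist (\<gamma> s) ?a - s + dist (\<sigma> u) ?c) (dist (\<gamma> s) ?c - s + dist (\<sigma> u) ?a) + 2 * \<delta>) at_top"
    proof (rule always_eventually, rule allI)
      fix s show "dist (\<gamma> s) (\<sigma> u) - s + dist ?a ?c \<le>
        max (dist (\<gamma> s) ?a - s + dist (\<sigma> u) ?c) (dist (\<gamma> s) ?c - s + dist (\<sigma> u) ?a) + 2 * \<delta>"
        using four_point[of "\<gamma> s" "\<sigma> u" ?a ?c] by linarith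
    qed
  qed simp
  moreover have "b ?a + (t - u) = b ?c + (u + t)" by (simp add: u_def field_simps)
  ultimately have "b (\<sigma> u) + 2 * t \<le> b ?a + (t - u) + 2 * \<delta>" using d ac by simp
  then have "b (\<sigma> u) \<le> horo_product ?a ?c + 2 * \<delta>"
    using ac by (simp add: horo_product_def u_def field_simps)
  then show thesis by (rule that)
qed

section \<open>Heights compared with products along representative rays\<close>

context
  fixes \<eta>1 \<eta>2 :: "(real \<Rightarrow> 'a) set" and \<tau>1 \<tau>2 :: "real \<Rightarrow> 'a"
  assumes eta1: "\<eta>1 \<in> gromov_boundary" "\<eta>1 \<noteq> \<xi>" "\<tau>1 \<in> \<eta>1"
    and eta2: "\<eta>2 \<in> gromov_boundary" "\<eta>2 \<noteq> \<xi>" "\<tau>2 \<in> \<eta>2"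
begin

text \<open>Each ray eventually has product at least \<open>c\<close> with the half of \<sigma> in
  its class, so exchanging both ends costs \<open>2 * \<delta>\<close>. The cap \<open>c\<close> is
  finite because those products are only eventually large. The representatives are arbitrary, so one
  ray per boundary point will serve all pairs.\<close>

lemma horo_product_compare_geodesic:
  assumes \<sigma>: "geodesic_between \<eta>1 \<eta>2 \<sigma>"
  shows "eventually (\<lambda>t. min c (horo_product (\<sigma> (- t)) (\<sigma> t)) - 2 * \<delta> \<le> horo_product (\<tau>1 t) (\<tau>2 t)) at_top"
    and "eventually (\<lambda>t. min c (horo_product (\<tau>1 t) (\<tau>2 t)) - 2 * \<delta> \<le> horo_product (\<sigma> (- t)) (\<sigma> t)) at_top"
proof -
  have in1: "(\<lambda>t. \<sigma> (- t)) \<in> \<eta>1" and in2: "\<sigma> \<in> \<eta>2"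
    using \<sigma> by (auto simp: geodesic_between_def)
  note ev = horo_product_asymp_at_top[OF eta1 in1, of c] horo_product_asymp_at_top[OF eta2 in2, of c]
  show "eventually (\<lambda>t. min c (horo_product (\<sigma> (- t)) (\<sigma> t)) - 2 * \<delta> \<le> horo_product (\<tau>1 t) (\<tau>2 t)) at_top"
    using ev
  proof eventually_elim
    case (elim t)
    then show ?case
      by (intro horo_product_ge2[of _ _ "\<sigma> (- t)" "\<sigma> t"])
         (auto simp: horo_product_commute[of "\<sigma> t"])
  qed
  show "eventually (\<lambda>t. min c (horo_product (\<tau>1 t) (\<tau>2 t)) - 2 * \<delta> \<le> horo_product (\<sigma> (- t)) (\<sigma> t)) at_top"
    using ev
  proof eventually_elim
    case (elim t)
    then show ?case
      by (intro horo_product_ge2[of _ _ "\<tau>1 t" "\<tau>2 t"])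
         (auto simp: horo_product_commute[of "\<sigma> (- t)" "\<tau>1 t"] horo_product_commute[of "\<tau>2 t"])
  qed
qed

text \<open>The infimum in \<open>H_fun\<close> is informative only over a set bounded below. Up to
  constants, \<open>b\<close> grows at least at unit speed along both rays and their distance at
  most at double speed, so the products are at least some \<open>m\<close>, which does not depend on
  \<sigma>.\<close>

lemma H_set_bdd_below:
  "bdd_below {busemann \<xi> p x |x \<sigma>. geodesic_between \<eta>1 \<eta>2 \<sigma> \<and> x \<in> range \<sigma>}"
proof -
  obtain K1 where K1: "\<And>t. t \<ge> 0 \<Longrightarrow> t - K1 \<le> b (\<tau>1 t)" using b_along_ray_ge[OF eta1] by blast
  obtain K2 where K2: "\<And>t. t \<ge> 0 \<Longrightarrow> t - K2 \<le> b (\<tau>2 t)" using b_along_ray_ge[OF eta2] by blast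
  define m where "m = - (K1 + K2 + dist (\<tau>1 0) (\<tau>2 0)) / 2"
  have m: "m \<le> horo_product (\<tau>1 t) (\<tau>2 t)" if t: "t \<ge> 0" for t
  proof -
    have "dist (\<tau>1 0) (\<tau>1 t) = t" "dist (\<tau>2 0) (\<tau>2 t) = t"
      using boundary_ray[OF eta1(1,3)] boundary_ray[OF eta2(1,3)] t by (auto simp: geodesic_ray_def)
    then have "dist (\<tau>1 t) (\<tau>2 t) \<le> 2 * t + dist (\<tau>1 0) (\<tau>2 0)"
      using dist_triangle[of "\<tau>1 t" "\<tau>2 t" "\<tau>1 0"] dist_triangle[of "\<tau>1 0" "\<tau>2 t" "\<tau>2 0"]
      by (simp add: dist_commute)
    then show ?thesis using K1[OF t] K2[OF t] by (simp add: horo_product_def m_def)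
  qed
  have "m - 2 * \<delta> \<le> b (\<sigma> u)" if \<sigma>: "geodesic_between \<eta>1 \<eta>2 \<sigma>" for \<sigma> u
  proof -
    obtain t where t: "min m (horo_product (\<tau>1 t) (\<tau>2 t)) - 2 * \<delta> \<le> horo_product (\<sigma> (- t)) (\<sigma> t)"
      "\<bar>u\<bar> \<le> t"
      using eventually_happens'[OF trivial_limit_at_top_linorder
          eventually_conj[OF horo_product_compare_geodesic(2)[OF \<sigma>, of m] eventually_ge_at_top[of "\<bar>u\<bar>"]]]
      by blast
    then show ?thesis
      using m[of t] horo_product_le_b[of \<sigma> u t] \<sigma> by (simp add: geodesic_between_def)
  qed
  then have "m - 2 * \<delta> \<le> busemann \<xi> p (\<sigma> u)" if "geodesic_between \<eta>1 \<eta>2 \<sigma>" for \<sigma> u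
    using busemann_bounds(1) that order_trans by blast
  then show ?thesis by (intro bdd_belowI[of _ "m - 2 * \<delta>"]) auto
qed

text \<open>The loss consists of \<open>4 * \<delta>\<close> for passing from
  \<open>busemann\<close> to \<open>b\<close>, \<open>2 * \<delta>\<close> for passing from points
  of the geodesic to the product of its ends, and \<open>2 * \<delta>\<close> for exchanging the
  geodesic for the rays.\<close>

lemma horo_product_ge_of_H_fun:
  assumes "\<eta>1 \<noteq> \<eta>2" and h: "h < H_fun \<xi> p \<eta>1 \<eta>2"
  shows "eventually (\<lambda>t. h - 8 * \<delta> \<le> horo_product (\<tau>1 t) (\<tau>2 t)) at_top"
proof -
  obtain \<sigma> where \<sigma>: "geodesic_between \<eta>1 \<eta>2 \<sigma>"
    using bi_geodesic_exists[OF eta1(1) eta2(1) assms(1)] by blast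
  have bi: "bi_geodesic \<sigma>" using \<sigma> by (simp add: geodesic_between_def)
  have b: "h - 4 * \<delta> \<le> b (\<sigma> u)" for u
  proof -
    have "H_fun \<xi> p \<eta>1 \<eta>2 \<le> busemann \<xi> p (\<sigma> u)"
      unfolding H_fun_def by (rule cInf_lower[OF _ H_set_bdd_below]) (use \<sigma> in blast)
    then show ?thesis using h busemann_bounds(2)[of "\<sigma> u"] by simp
  qed
  show ?thesis
    using horo_product_compare_geodesic(1)[OF \<sigma>, of "h - 6 * \<delta>"] eventually_ge_at_top[of 0]
  proof eventually_elim
    case (elim t)
    obtain u where "b (\<sigma> u) \<le> horo_product (\<sigma> (- t)) (\<sigma> t) + 2 * \<delta>"
      using exists_b_le_horo_product[OF bi elim(2)] by blast
    then have "h - 6 * \<delta> \<le> horo_product (\<sigma> (- t)) (\<sigma> t)" using b[of u] by simp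
    then show ?case using elim(1) by simp
  qed
qed

text \<open>Some geodesic has a point with \<open>b\<close> below \<open>k\<close>. That value
  dominates the products of the ends of the geodesic, and passing to the rays costs
  \<open>2 * \<delta>\<close>.\<close>

lemma horo_product_le_of_H_fun:
  assumes "\<eta>1 \<noteq> \<eta>2" and k: "H_fun \<xi> p \<eta>1 \<eta>2 < k"
  shows "eventually (\<lambda>t. horo_product (\<tau>1 t) (\<tau>2 t) \<le> k + 2 * \<delta>) at_top"
proof -
  let ?S = "{busemann \<xi> p x |x \<sigma>. geodesic_between \<eta>1 \<eta>2 \<sigma> \<and> x \<in> range \<sigma>}"
  obtain \<sigma>0 where "geodesic_between \<eta>1 \<eta>2 \<sigma>0"
    using bi_geodesic_exists[OF eta1(1) eta2(1) assms(1)] by blast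
  then have "busemann \<xi> p (\<sigma>0 0) \<in> ?S" by blast
  then have "?S \<noteq> {}" by blast
  then obtain \<sigma> u where \<sigma>: "geodesic_between \<eta>1 \<eta>2 \<sigma>" and "busemann \<xi> p (\<sigma> u) < k"
    using cInf_lessD[of ?S k] k unfolding H_fun_def by blast
  then have u: "b (\<sigma> u) < k" using busemann_bounds(1)[of "\<sigma> u"] by simp
  \<comment> \<open>The cap exceeds \<open>k + 2 * \<delta>\<close>, so the minimum in the
    comparison must be the product along the rays.\<close>
  show ?thesis
    using horo_product_compare_geodesic(2)[OF \<sigma>, of "k + 2 * \<delta> + 1"] eventually_ge_at_top[of "\<bar>u\<bar>"]
  proof eventually_elim
    case (elim t)
    then show ?case
      using horo_product_le_b[of \<sigma> u t] \<sigma> u by (simp add: geodesic_between_def min_def split: if_splits)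
  qed
qed

end

section \<open>Transfer of separated boundary points into the space\<close>

lemma eventually_gromov_product_close:
  assumes "e > 0"
  shows "eventually (\<lambda>T. \<bar>gromov_product (\<gamma> T) x y - T - horo_product x y\<bar> \<le> e) at_top"
  using tendstoD[OF tendsto_horo_product assms, of x y]
  by eventually_elim (simp add: dist_real_def)

text \<open>Boundary points are replaced by points \<open>a \<zeta>\<close> far out on their rays,
  and \<xi> by a far point \<open>\<gamma> T\<close>. Finiteness of \<open>P\<close> lets all
  estimates hold at one \<open>t\<close> and one \<open>T\<close>.\<close>

lemma separated_points_of_boundary_points:
  assumes fin: "finite P" and P: "P \<subseteq> gromov_boundary - {\<xi>}" and \<eta>: "\<eta> \<in> gromov_boundary - {\<xi>}"
    and r: "r > 0" and L: "L \<ge> 0"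
    and low: "\<And>\<zeta>. \<lbrakk>\<zeta> \<in> P; \<zeta> \<noteq> \<eta>\<rbrakk> \<Longrightarrow> h < H_fun \<xi> p \<zeta> \<eta>"
    and high: "\<And>\<zeta> \<zeta>'. \<lbrakk>\<zeta> \<in> P; \<zeta>' \<in> P; \<zeta> \<noteq> \<zeta>'\<rbrakk> \<Longrightarrow> H_fun \<xi> p \<zeta> \<zeta>' < h + L"
  obtains x :: 'a and y where "\<And>\<zeta>. \<zeta> \<in> P \<Longrightarrow> dist x (y \<zeta>) \<le> L + r + 16 * \<delta> + 2"
    "\<And>\<zeta> \<zeta>'. \<lbrakk>\<zeta> \<in> P; \<zeta>' \<in> P; \<zeta> \<noteq> \<zeta>'\<rbrakk> \<Longrightarrow> 2 * r \<le> dist (y \<zeta>) (y \<zeta>')"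
proof -
  define Q where "Q = insert \<eta> P"
  have Q: "finite Q" "Q \<subseteq> gromov_boundary - {\<xi>}" using fin P \<eta> by (auto simp: Q_def)
  have "\<forall>\<zeta>\<in>Q. \<exists>\<tau>. \<tau> \<in> \<zeta>" using boundary_nonempty Q(2) by blast
  then obtain \<tau> where \<tau>: "\<And>\<zeta>. \<zeta> \<in> Q \<Longrightarrow> \<tau> \<zeta> \<in> \<zeta>" by metis
  have Qd: "\<zeta> \<in> gromov_boundary" "\<zeta> \<noteq> \<xi>" "\<tau> \<zeta> \<in> \<zeta>" if "\<zeta> \<in> Q" for \<zeta>
    using that Q(2) \<tau> by auto
  have PQ: "\<zeta> \<in> Q" if "\<zeta> \<in> P" for \<zeta> using that by (simp add: Q_def)
  have \<eta>Q: "\<eta> \<in> Q" by (simp add: Q_def)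
  \<comment> \<open>Mutual products will be at most \<open>h + L + 2 * \<delta>\<close>;
    \<open>separated_points_in_ball\<close> asks for a further gap of
    \<open>r + 2 * \<delta>\<close>, and 2 pays for two approximation errors of size 1.\<close>
  define k where "k = h + L + r + 4 * \<delta> + 2"
  have "eventually (\<lambda>t. \<forall>\<zeta>\<in>Q. k \<le> b (\<tau> \<zeta> t)) at_top"
    by (intro eventually_ball_finite Q(1) ballI b_along_ray_at_top[OF Qd])
  moreover have "eventually (\<lambda>t. \<forall>\<zeta>\<in>P. h - 8 * \<delta> \<le> horo_product (\<tau> \<zeta> t) (\<tau> \<eta> t)) at_top"
  proof (intro eventually_ball_finite fin ballI)
    fix \<zeta> assume \<zeta>: "\<zeta> \<in> P"
    show "eventually (\<lambda>t. h - 8 * \<delta> \<le> horo_product (\<tau> \<zeta> t) (\<tau> \<eta> t)) at_top"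
    proof (cases "\<zeta> = \<eta>")
      \<comment> \<open>The height bounds say nothing about \<eta> paired with itself; there the
        product is \<open>b\<close> along the ray, which tends to infinity.\<close>
      case True
      then show ?thesis using horo_product_asymp_at_top[OF Qd(1,2,3)[OF \<eta>Q] Qd(3)[OF \<eta>Q]] by simp
    next
      case False
      then show ?thesis
        using horo_product_ge_of_H_fun[OF Qd[OF PQ[OF \<zeta>]] Qd[OF \<eta>Q]] low[OF \<zeta>] by blast
    qed
  qed
  moreover have "eventually (\<lambda>t. \<forall>\<zeta>\<in>P. \<forall>\<zeta>'\<in>P. \<zeta> \<noteq> \<zeta>' \<longrightarrow>
      horo_product (\<tau> \<zeta> t) (\<tau> \<zeta>' t) \<le> h + L + 2 * \<delta>) at_top"
  proof (intro eventually_ball_finite fin ballI)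
    fix \<zeta> \<zeta>' assume \<zeta>: "\<zeta> \<in> P" "\<zeta>' \<in> P"
    show "eventually (\<lambda>t. \<zeta> \<noteq> \<zeta>' \<longrightarrow> horo_product (\<tau> \<zeta> t) (\<tau> \<zeta>' t) \<le> h + L + 2 * \<delta>) at_top"
      using horo_product_le_of_H_fun[OF Qd[OF PQ[OF \<zeta>(1)]] Qd[OF PQ[OF \<zeta>(2)]]] high[OF \<zeta>]
      by (cases "\<zeta> = \<zeta>'") auto
  qed
  ultimately have "eventually (\<lambda>t. (\<forall>\<zeta>\<in>Q. k \<le> b (\<tau> \<zeta> t)) \<and>
      (\<forall>\<zeta>\<in>P. h - 8 * \<delta> \<le> horo_product (\<tau> \<zeta> t) (\<tau> \<eta> t)) \<and>
      (\<forall>\<zeta>\<in>P. \<forall>\<zeta>'\<in>P. \<zeta> \<noteq> \<zeta>' \<longrightarrow> horo_product (\<tau> \<zeta> t) (\<tau> \<zeta>' t) \<le> h + L + 2 * \<delta>)) at_top"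
    by eventually_elim blast
  from eventually_happens'[OF trivial_limit_at_top_linorder this]
  obtain t where t': "\<forall>\<zeta>\<in>Q. k \<le> b (\<tau> \<zeta> t)"
    "\<forall>\<zeta>\<in>P. h - 8 * \<delta> \<le> horo_product (\<tau> \<zeta> t) (\<tau> \<eta> t)"
    "\<forall>\<zeta>\<in>P. \<forall>\<zeta>'\<in>P. \<zeta> \<noteq> \<zeta>' \<longrightarrow> horo_product (\<tau> \<zeta> t) (\<tau> \<zeta>' t) \<le> h + L + 2 * \<delta>"
    by (elim exE conjE)
  note t = t'[rule_format]
  define a where "a \<zeta> = \<tau> \<zeta> t" for \<zeta>
  have "eventually (\<lambda>T. \<forall>\<zeta>\<in>Q. \<forall>\<zeta>'\<in>Q.
      \<bar>gromov_product (\<gamma> T) (a \<zeta>) (a \<zeta>') - T - horo_product (a \<zeta>) (a \<zeta>')\<bar> \<le> 1) at_top"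
    using Q(1) by (intro eventually_ball_finite ballI eventually_gromov_product_close) auto
  then have "eventually (\<lambda>T. 0 \<le> T + h - 8 * \<delta> - 1 \<and> (\<forall>\<zeta>\<in>Q. \<forall>\<zeta>'\<in>Q.
      \<bar>gromov_product (\<gamma> T) (a \<zeta>) (a \<zeta>') - T - horo_product (a \<zeta>) (a \<zeta>')\<bar> \<le> 1)) at_top"
    using eventually_ge_at_top[of "1 + 8 * \<delta> - h"] by eventually_elim simp
  from eventually_happens'[OF trivial_limit_at_top_linorder this]
  obtain T where T0: "0 \<le> T + h - 8 * \<delta> - 1" and T': "\<forall>\<zeta>\<in>Q. \<forall>\<zeta>'\<in>Q.
      \<bar>gromov_product (\<gamma> T) (a \<zeta>) (a \<zeta>') - T - horo_product (a \<zeta>) (a \<zeta>')\<bar> \<le> 1"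
    by (elim exE conjE)
  note T = T'[rule_format]
  \<comment> \<open>The product of a point with itself is its distance from the base point, and
    \<open>horo_product\<close> of a point with itself is \<open>b\<close>, so this is the
    approximation with equal arguments.\<close>
  have Tb: "T + k - 1 \<le> dist (\<gamma> T) (a \<zeta>)" if "\<zeta> \<in> Q" for \<zeta>
    using T[OF that that] t(1)[OF that] by (simp add: gromov_product_def horo_product_def a_def)
  \<comment> \<open>Height \<open>h\<close> corresponds to distance about \<open>T + h\<close> from
    \<open>\<gamma> T\<close>. The level \<open>s0\<close> allows for the loss
    \<open>8 * \<delta>\<close> in the lower product bound, and both levels for an error of
    1.\<close>
  define s0 s where "s0 = T + h - 8 * \<delta> - 1" and "s = T + k - 1"
  show thesis
  proof (rule separated_points_in_ball[of s0 s r "\<gamma> T" "a \<eta>" P a])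
    show "0 \<le> s0" "s0 \<le> s" using T0 delta_nonneg L r by (auto simp: s0_def s_def k_def)
    show "0 < r" by (rule r)
    show "s0 \<le> dist (\<gamma> T) (a \<eta>)"
      using Tb[OF \<eta>Q] delta_nonneg L r by (simp add: s0_def k_def)
    show "s \<le> dist (\<gamma> T) (a \<zeta>)" if "\<zeta> \<in> P" for \<zeta>
      using Tb[OF PQ[OF that]] by (simp add: s_def)
    show "s0 \<le> gromov_product (\<gamma> T) (a \<zeta>) (a \<eta>)" if "\<zeta> \<in> P" for \<zeta>
      using T[OF PQ[OF that] \<eta>Q] t(2)[OF that] by (simp add: s0_def a_def abs_le_iff)
    show "gromov_product (\<gamma> T) (a \<zeta>) (a \<zeta>') \<le> s - r - 2 * \<delta>" if "\<zeta> \<in> P" "\<zeta>' \<in> P" "\<zeta> \<noteq> \<zeta>'" for \<zeta> \<zeta>'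
      using T[OF PQ[OF that(1)] PQ[OF that(2)]] t(3)[OF that] by (simp add: s_def k_def a_def abs_le_iff)
    fix x :: 'a and y
    assume 1: "\<And>\<zeta>. \<zeta> \<in> P \<Longrightarrow> dist x (y \<zeta>) \<le> s - s0 + 4 * \<delta>"
      and 2: "\<And>\<zeta> \<zeta>'. \<lbrakk>\<zeta> \<in> P; \<zeta>' \<in> P; \<zeta> \<noteq> \<zeta>'\<rbrakk> \<Longrightarrow> 2 * r \<le> dist (y \<zeta>) (y \<zeta>')"
    have eq: "s - s0 + 4 * \<delta> = L + r + 16 * \<delta> + 2" by (simp add: s_def s0_def k_def)
    show thesis by (rule that[OF 1[unfolded eq] 2])
  qed
qed

end

section \<open>Heights read off from a parabolic visual metric\<close>

theorem theorem5p5: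
  fixes \<delta> \<epsilon>0 \<epsilon> :: real
    and \<xi> :: "(real \<Rightarrow> 'a::metric_space) set"
    and p :: 'a
    and d :: "(real \<Rightarrow> 'a) set \<Rightarrow> (real \<Rightarrow> 'a) set \<Rightarrow> real"
  assumes hyp: "delta_hyperbolic \<delta> TYPE('a)"
    and proper: "proper_metric TYPE('a)"
    and geod: "geodesic_metric TYPE('a)"
    and growth: "bounded_growth_some_scale TYPE('a)"
    and eps0_pos: "0 < \<epsilon>0"
    and eps0: "\<forall>\<xi>'\<in>(gromov_boundary :: (real \<Rightarrow> 'a) set set). \<forall>p'::'a. \<forall>e. 0 < e \<and> e \<le> \<epsilon>0 \<longrightarrow>
                 (\<exists>d'. parabolic_visual_metric \<xi>' p' e d')"
    and xi: "\<xi> \<in> gromov_boundary"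
    and eps: "0 < \<epsilon>" "\<epsilon> \<le> \<epsilon>0"
    and d: "parabolic_visual_metric \<xi> p \<epsilon> d"
  shows "doubling_on (gromov_boundary - {\<xi>}) d"
proof -
  interpret hyperbolic_geodesic_space \<delta> "TYPE('a)"
    by unfold_locales (fact hyp proper geod)+
  obtain \<gamma> where \<gamma>: "\<gamma> \<in> \<xi>" "\<gamma> 0 = p" using ray_from_point_exists[OF xi] by blast
  interpret hyperbolic_space_ray \<delta> "TYPE('a)" \<xi> p \<gamma>
    by unfold_locales (fact xi \<gamma>)+
  let ?S = "gromov_boundary - {\<xi>}"
  have metric: "metric_on ?S d"
    and D_le: "\<And>\<zeta> \<zeta>'. \<lbrakk>\<zeta> \<in> ?S; \<zeta>' \<in> ?S; \<zeta> \<noteq> \<zeta>'\<rbrakk> \<Longrightarrow> D_fun \<xi> p \<epsilon> \<zeta> \<zeta>' / 2 \<le> d \<zeta> \<zeta>'"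
    and le_D: "\<And>\<zeta> \<zeta>'. \<lbrakk>\<zeta> \<in> ?S; \<zeta>' \<in> ?S; \<zeta> \<noteq> \<zeta>'\<rbrakk> \<Longrightarrow> d \<zeta> \<zeta>' \<le> D_fun \<xi> p \<epsilon> \<zeta> \<zeta>'"
    using d unfolding parabolic_visual_metric_def by blast+
  obtain r where r: "r > 0" and sep: "\<forall>\<rho>. \<exists>N. \<forall>(x::'a) (P::'a set). finite P \<longrightarrow> P \<subseteq> ball x \<rho> \<longrightarrow>
       (\<forall>y\<in>P. \<forall>z\<in>P. y \<noteq> z \<longrightarrow> 2 * r \<le> dist y z) \<longrightarrow> card P \<le> N"
    by (rule bounded_growth_separated[OF geod growth]) (rule that; assumption)
  \<comment> \<open>The values \<open>2 * R\<close> and \<open>R / 2\<close> of \<open>D_fun\<close>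
    differ by a factor 4, that is by \<open>ln 4 / \<epsilon>\<close> in height; the summand 1 makes
    the upper bound strict.\<close>
  define L where "L = ln 4 / \<epsilon> + 1"
  have L: "L \<ge> 0" using eps by (simp add: L_def)
  \<comment> \<open>The radius exceeds the non-strict bound on distances by 1 because balls are
    open. It involves neither the centre nor the radius of the boundary ball, so \<open>N\<close> is
    uniform.\<close>
  obtain N where N: "\<forall>(x::'a) P. finite P \<longrightarrow> P \<subseteq> ball x (L + r + 16 * \<delta> + 3) \<longrightarrow>
      (\<forall>y\<in>P. \<forall>z\<in>P. y \<noteq> z \<longrightarrow> 2 * r \<le> dist y z) \<longrightarrow> card P \<le> N"
    using spec[OF sep, of "L + r + 16 * \<delta> + 3"] by (elim exE)
  show ?thesis
  proof (rule doubling_on_if_separated_bounded[OF metric])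
    fix \<eta> and R :: real and P
    assume \<eta>: "\<eta> \<in> ?S" and R: "R > 0" and fin: "finite P" and P: "P \<subseteq> {\<zeta> \<in> ?S. d \<eta> \<zeta> < R}"
      and apart: "\<And>y z. \<lbrakk>y \<in> P; z \<in> P; y \<noteq> z\<rbrakk> \<Longrightarrow> R / 2 \<le> d y z"
    \<comment> \<open>From \<open>d < R\<close> and the lower comparison with \<open>D_fun\<close>,
      the value of \<open>D_fun\<close> is below \<open>2 * R\<close>, which is height above
      \<open>h\<close>.\<close>
    define h where "h = - ln (2 * R) / \<epsilon>"
    have PS: "P \<subseteq> ?S" using P by blast
    have low: "h < H_fun \<xi> p \<zeta> \<eta>" if "\<zeta> \<in> P" "\<zeta> \<noteq> \<eta>" for \<zeta>
    proof -
      have \<zeta>: "\<zeta> \<in> ?S" "d \<eta> \<zeta> < R" using P that(1) by blast+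
      have "d \<zeta> \<eta> = d \<eta> \<zeta>" using metric \<eta> \<zeta>(1) unfolding metric_on_def by blast
      then have "exp (- \<epsilon> * H_fun \<xi> p \<zeta> \<eta>) < 2 * R"
        using D_le[OF \<zeta>(1) \<eta> that(2)] \<zeta>(2) unfolding D_fun_def by linarith
      then have "- \<epsilon> * H_fun \<xi> p \<zeta> \<eta> < ln (2 * R)"
        using R by (metis exp_less_cancel_iff exp_ln mult_pos_pos zero_less_numeral)
      then have "- ln (2 * R) < H_fun \<xi> p \<zeta> \<eta> * \<epsilon>"
        by (simp add: mult.commute[of _ \<epsilon>])
      then show ?thesis unfolding h_def pos_divide_less_eq[OF eps(1)] .
    qed
    have high: "H_fun \<xi> p \<zeta> \<zeta>' < h + L" if "\<zeta> \<in> P" "\<zeta>' \<in> P" "\<zeta> \<noteq> \<zeta>'" for \<zeta> \<zeta>'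
    proof -
      have "R / 2 \<le> exp (- \<epsilon> * H_fun \<xi> p \<zeta> \<zeta>')"
        using apart[OF that] le_D[OF _ _ that(3)] that(1,2) PS unfolding D_fun_def
        by (meson order_trans subsetD)
      then have "ln (R / 2) \<le> - \<epsilon> * H_fun \<xi> p \<zeta> \<zeta>'"
        using R by (metis exp_le_cancel_iff exp_ln half_gt_zero)
      moreover have "ln (2 * R) = ln (R / 2) + ln 4"
        using R ln_mult[of "R / 2" 4] by (simp add: mult.commute)
      ultimately have "\<epsilon> * H_fun \<xi> p \<zeta> \<zeta>' \<le> ln 4 - ln (2 * R)" by simp
      then have "H_fun \<xi> p \<zeta> \<zeta>' \<le> (ln 4 - ln (2 * R)) / \<epsilon>"
        using eps by (simp add: le_divide_eq mult.commute)
      then show ?thesis by (simp add: h_def L_def diff_divide_distrib)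
    qed
    show "card P \<le> N"
    proof (rule separated_points_of_boundary_points[OF fin PS \<eta> r L])
      show "h < H_fun \<xi> p \<zeta> \<eta>" if "\<zeta> \<in> P" "\<zeta> \<noteq> \<eta>" for \<zeta>
        by (rule low[OF that])
      show "H_fun \<xi> p \<zeta> \<zeta>' < h + L" if "\<zeta> \<in> P" "\<zeta>' \<in> P" "\<zeta> \<noteq> \<zeta>'" for \<zeta> \<zeta>'
        by (rule high[OF that])
      fix x :: 'a and y
      assume xy: "\<And>\<zeta>. \<zeta> \<in> P \<Longrightarrow> dist x (y \<zeta>) \<le> L + r + 16 * \<delta> + 2"
        "\<And>\<zeta> \<zeta>'. \<lbrakk>\<zeta> \<in> P; \<zeta>' \<in> P; \<zeta> \<noteq> \<zeta>'\<rbrakk> \<Longrightarrow> 2 * r \<le> dist (y \<zeta>) (y \<zeta>')"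
      have "inj_on y P"
      proof (rule inj_onI, rule ccontr)
        fix \<zeta> \<zeta>' assume "\<zeta> \<in> P" "\<zeta>' \<in> P" "y \<zeta> = y \<zeta>'" "\<zeta> \<noteq> \<zeta>'"
        then show False using xy(2)[of \<zeta> \<zeta>'] r by simp
      qed
      then have "card P = card (y ` P)" by (simp add: card_image)
      also have "\<dots> \<le> N"
      proof (rule N[rule_format])
        show "finite (y ` P)" using fin by simp
        show "y ` P \<subseteq> ball x (L + r + 16 * \<delta> + 3)"
        proof (rule image_subsetI)
          fix \<zeta> assume "\<zeta> \<in> P"
          then show "y \<zeta> \<in> ball x (L + r + 16 * \<delta> + 3)" using xy(1)[of \<zeta>] by simp
        qed
        fix u v assume "u \<in> y ` P" "v \<in> y ` P" "u \<noteq> v"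
        then obtain \<zeta> \<zeta>' where "\<zeta> \<in> P" "\<zeta>' \<in> P" "u = y \<zeta>" "v = y \<zeta>'" by blast
        with \<open>u \<noteq> v\<close> show "2 * r \<le> dist u v" using xy(2)[of \<zeta> \<zeta>'] by metis
      qed
      finally show "card P \<le> N" .
    qed
  qed
qed

end
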